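(* Let $R=K[x_1,\ldots,x_n]$ be a polynomial ring over a field $K$, let $I\subset R$ be a monomial ideal with minimal monomial generating set $G(I)$, and let $x_i$ be a variable that occurs in (divides some element of) $G(I)$. Put $$q=\max\{\deg_{x_i}(x^a)\mid x^a\in G(I)\},\quad \mathcal{B}_i=\{x^a\in G(I)\mid \deg_{x_i}(x^a)=q\},\quad \mathcal{A}_i=G(I)\setminus\mathcal{B}_i,$$ $$p=\max\{\deg_{x_i}(x^a)\mid x^a\in\mathcal{A}_i\},\qquad L=\bigl(\{x^a/x_i\mid x^a\in\mathcal{B}_i\}\cup\mathcal{A}_i\bigr),\qquad L'=\bigl(\{x^a/x_i^{q-1}\mid x^a\in\mathcal{B}_i\}\cup\mathcal{A}_i\bigr).$$ Then the following hold. (a) If $p\geq 1$ and $q-p\geq 2$, then $\operatorname{reg}(R/L)\leq\operatorname{reg}(R/I)\leq\operatorname{reg}(R/L)+1$. (b) If $p\geq 0$ and $q-p=1$, then $\operatorname{reg}(R/L)\leq\operatorname{reg}(R/I)$. (c) If $p=0$ and $q\geq 2$, then $\operatorname{reg}(R/L')\leq\operatorname{reg}(R/I)\leq\operatorname{reg}(R/L')+q-1$.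
   Context: For a monomial $x^a=x_1^{a_1}\cdots x_n^{a_n}$, $\deg_{x_i}(x^a)=a_i$. $G(I)$ is the unique minimal set of monomial generators of $I$. $\operatorname{reg}$ is Castelnuovo--Mumford regularity over $R$ with its standard grading, and $\operatorname{reg}(0)=-\infty$. If $\mathcal{A}_i=\emptyset$, then $p=0$ by convention. *)

theory Defs
  imports
    "HOL-Library.Poly_Mapping"
    "HOL-Library.Extended_Real"
    "Jordan_Normal_Form.Matrix_Kernel"
begin

text \<open>
  For a finite type \<open>'n\<close> of variables, the polynomial ring \<open>R = K[x\<^sub>v | v \<in> 'n]\<close> is the type
  \<open>('n \<Rightarrow>\<^sub>0 nat) \<Rightarrow>\<^sub>0 'k\<close>; its multiplication is the convolution product.
  A polynomial maps exponent vectors to coefficients.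
\<close>

type_synonym 'n expo = "'n \<Rightarrow>\<^sub>0 nat"
type_synonym ('n, 'k) pol = "('n \<Rightarrow>\<^sub>0 nat) \<Rightarrow>\<^sub>0 'k"

definition monomial :: "'n expo \<Rightarrow> ('n, 'k::field) pol" where
  "monomial a = Poly_Mapping.single a 1"

text \<open>Ideals of \<open>R\<close> are the submodules of \<open>R\<close> as a module over itself.\<close>

definition ideal_generated :: "'r::comm_ring_1 set \<Rightarrow> 'r set" where
  "ideal_generated B = Modules.module.span (*) B"

text \<open>Monomial ideals; sets of monomials are represented by sets of exponent vectors.\<close>

definition monomial_generators :: "'n expo set \<Rightarrow> ('n, 'k::field) pol set \<Rightarrow> bool" where
  "monomial_generators A I \<longleftrightarrow> I = ideal_generated (monomial ` A)"

definition monomial_ideal :: "('n, 'k::field) pol set \<Rightarrow> bool" where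
  "monomial_ideal I \<longleftrightarrow> (\<exists>A. monomial_generators A I)"

definition min_gens :: "('n, 'k::field) pol set \<Rightarrow> 'n expo set" where
  "min_gens I = (THE A. monomial_generators A I \<and> (\<forall>A'. A' \<subset> A \<longrightarrow> \<not> monomial_generators A' I))"


text \<open>The standard grading. The zero polynomial is homogeneous of every degree, and the only
  homogeneous polynomial of a negative degree.\<close>

definition total_degree :: "'n::finite expo \<Rightarrow> nat" where
  "total_degree a = (\<Sum>v\<in>UNIV. Poly_Mapping.lookup a v)"

definition homogeneous_of_degree :: "int \<Rightarrow> ('n::finite, 'k::field) pol \<Rightarrow> bool" where
  "homogeneous_of_degree d f \<longleftrightarrow> (\<forall>a \<in> Poly_Mapping.keys f. int (total_degree a) = d)"

definition irrelevant_ideal :: "('n::finite, 'k::field) pol set" where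
  "irrelevant_ideal = ideal_generated (range (\<lambda>v. monomial (Poly_Mapping.single v 1)))"


text \<open>
  A graded free resolution \<open>\<dots> \<rightarrow> F\<^sub>2 \<rightarrow> F\<^sub>1 \<rightarrow> F\<^sub>0 \<rightarrow> R/I \<rightarrow> 0\<close> by free modules of finite rank.
  The list \<open>s i\<close> contains the degrees of the basis elements of \<open>F\<^sub>i\<close>, so that \<open>F\<^sub>i\<close> is the direct
  sum of the shifted modules \<open>R(-j)\<close>, \<open>j\<close> ranging over \<open>s i\<close> with repetitions; \<open>F\<^sub>i = 0\<close> if \<open>s i\<close> is
  empty. The matrix \<open>D i\<close> describes the map \<open>F\<^sub>i\<^sub>+\<^sub>1 \<rightarrow> F\<^sub>i\<close>. The augmentation \<open>F\<^sub>0 \<rightarrow> R/I\<close> sends the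
  basis to the residue classes of the entries of the vector \<open>\<epsilon>\<close>. Its kernel and its surjectivity
  are expressed by means of representatives in \<open>R\<close>. A homogeneous element of degree \<open>j\<close> of \<open>R/I\<close>, for a
  homogeneous ideal \<open>I\<close>, has a representative that is homogeneous of degree \<open>j\<close>, which is what
  the condition on \<open>\<epsilon>\<close> asks for.
\<close>

definition graded_free_resolution ::
  "('n::finite, 'k::field) pol set \<Rightarrow> (nat \<Rightarrow> int list) \<Rightarrow> ('n, 'k) pol vec \<Rightarrow> (nat \<Rightarrow> ('n, 'k) pol mat) \<Rightarrow> bool"
where
  "graded_free_resolution I s \<epsilon> D \<longleftrightarrow>
     \<comment> \<open>the maps are homogeneous of degree 0\<close>
     \<epsilon> \<in> carrier_vec (length (s 0)) \<and>
     (\<forall>k < length (s 0). homogeneous_of_degree (s 0 ! k) (\<epsilon> $ k)) \<and>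
     (\<forall>i. D i \<in> carrier_mat (length (s i)) (length (s (Suc i)))) \<and>
     (\<forall>i. \<forall>j < length (s i). \<forall>k < length (s (Suc i)).
        homogeneous_of_degree (s (Suc i) ! k - s i ! j) (D i $$ (j, k))) \<and>
     \<comment> \<open>exactness at \<open>R/I\<close>, at \<open>F\<^sub>0\<close> and at \<open>F\<^sub>i\<^sub>+\<^sub>1\<close>\<close>
     (\<forall>f. \<exists>v \<in> carrier_vec (length (s 0)). f - \<epsilon> \<bullet> v \<in> I) \<and>
     {v \<in> carrier_vec (length (s 0)). \<epsilon> \<bullet> v \<in> I} =
       (\<lambda>w. D 0 *\<^sub>v w) ` carrier_vec (length (s 1)) \<and>
     (\<forall>i. mat_kernel (D i) = (\<lambda>w. D (Suc i) *\<^sub>v w) ` carrier_vec (length (s (Suc (Suc i)))))"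

text \<open>Minimality: the image of \<open>F\<^sub>i\<^sub>+\<^sub>1\<close> is contained in \<open>\<mm> F\<^sub>i\<close>, where \<open>\<mm>\<close> is the irrelevant ideal.\<close>

definition minimal_graded_free_resolution ::
  "('n::finite, 'k::field) pol set \<Rightarrow> (nat \<Rightarrow> int list) \<Rightarrow> ('n, 'k) pol vec \<Rightarrow> (nat \<Rightarrow> ('n, 'k) pol mat) \<Rightarrow> bool"
where
  "minimal_graded_free_resolution I s \<epsilon> D \<longleftrightarrow>
     graded_free_resolution I s \<epsilon> D \<and>
     (\<forall>i. \<forall>j < length (s i). \<forall>k < length (s (Suc i)). D i $$ (j, k) \<in> irrelevant_ideal)"

text \<open>
  The graded Betti number \<open>\<beta>\<^sub>i\<^sub>,\<^sub>j(R/I)\<close> is the number of summands \<open>R(-j)\<close> of \<open>F\<^sub>i\<close> in the minimal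
  graded free resolution of \<open>R/I\<close>, which exists for every homogeneous ideal \<open>I\<close> and is unique up
  to isomorphism.
\<close>

definition betti :: "('n::finite, 'k::field) pol set \<Rightarrow> nat \<Rightarrow> int \<Rightarrow> nat" where
  "betti I i j =
     count_list ((SOME s. \<exists>\<epsilon> D. minimal_graded_free_resolution I s \<epsilon> D) i) j"

text \<open>\<open>reg(R/I) = max {j - i | \<beta>\<^sub>i\<^sub>,\<^sub>j(R/I) \<noteq> 0}\<close>. The supremum over the empty set, which occurs for \<open>I = R\<close>,
  is \<open>-\<infinity>\<close>.\<close>

definition reg_quotient :: "('n::finite, 'k::field) pol set \<Rightarrow> ereal" where
  "reg_quotient I = Sup {ereal (real_of_int (j - int i)) | i j. betti I i j \<noteq> 0}"

end

theory Submission
  imports Defs "HOL-Library.Function_Algebras"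
begin

text \<open>
  The ideals \<open>I\<close>, \<open>L\<close> and \<open>L'\<close> have the same generators up to a change of the exponents of \<open>x\<close>. Let \<open>\<Phi>\<close> be
  a map on exponent vectors which is a lower adjoint for divisibility: \<open>\<Phi> a\<close> divides \<open>b\<close> iff \<open>a\<close>
  divides \<open>\<Psi> b\<close>. A multigraded free resolution of the quotient by the ideal with generators \<open>A\<close>
  consists of lists of multidegrees and of matrices of scalars, a scalar \<open>c\<close> between the degrees \<open>a\<close>
  and \<open>a'\<close> standing for the entry \<open>c x^(a' - a)\<close>. Such data is exact iff for every degree \<open>b\<close> the strand
  on the basis elements whose degree divides \<open>b\<close> is exact. If \<open>\<Phi>\<close> is applied to all
  the multidegrees and the scalars are kept, the strand at \<open>b\<close> becomes the old strand at \<open>\<Psi> b\<close>; so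
  this gives a resolution for the ideal with generators \<open>\<Phi> ` A\<close>
  (\<open>scalar_resolution_relabel\<close>). It need not be minimal, but the degrees of a minimal
  resolution occur in every graded resolution, at the same homological position
  (\<open>minimal_resolution_degrees_subset\<close>). Hence if \<open>\<Phi>\<close> raises
  total degrees by at most \<open>c\<close>, it raises the regularity by at most \<open>c\<close>
  (\<open>reg_quotient_relabel_le\<close>).

  All inequalities are instances for a monotone map of the exponent of \<open>x\<close> that fixes \<open>0\<close>. Lowering
  every exponent \<open>\<ge> q\<close> by one takes \<open>I\<close> to \<open>L\<close>; if \<open>q - 1\<close> is still larger than \<open>p \<ge> 1\<close>, raising every
  exponent \<open>\<ge> q - 1\<close> by one goes back. When the exponents of \<open>x\<close> in the generators are \<open>0\<close> and \<open>q\<close> only,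
  a map that sends \<open>q\<close> to \<open>1\<close> takes \<open>I\<close> to \<open>L'\<close>, and one that sends \<open>1\<close> to \<open>q\<close> goes back.

  For the regularity to be accessible, minimal resolutions of monomial ideals have to exist.
  They are built multigraded, degree by degree: by Dickson's lemma there are finitely many generators, so
  all multidegrees can be kept below their product, and each syzygy module is generated by finitely many
  finite-dimensional strands.
\<close>

section \<open>Exponent vectors and products of polynomials\<close>

abbreviation "lookup \<equiv> Poly_Mapping.lookup"
abbreviation "keys \<equiv> Poly_Mapping.keys"
abbreviation "single \<equiv> Poly_Mapping.single"

text \<open>
  Divisibility of monomials, as opposed to the lexicographic order \<open>\<le>\<close> on exponent vectors.
\<close>

definition expo_le :: "'n expo \<Rightarrow> 'n expo \<Rightarrow> bool" (infix \<open>\<preceq>\<close> 50) where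
  "a \<preceq> b \<longleftrightarrow> (\<forall>v. lookup a v \<le> lookup b v)"

lemma expo_le_refl [simp]: "a \<preceq> a"
  by (simp add: expo_le_def)

lemma expo_le_trans: "a \<preceq> b \<Longrightarrow> b \<preceq> c \<Longrightarrow> a \<preceq> c"
  unfolding expo_le_def by (meson le_trans)

lemma expo_le_antisym: "a \<preceq> b \<Longrightarrow> b \<preceq> a \<Longrightarrow> a = b"
  unfolding expo_le_def by (intro poly_mapping_eqI) (metis le_antisym)

lemma zero_expo_le [simp]: "0 \<preceq> a"
  by (simp add: expo_le_def)

lemma expo_le_zero [simp]: "a \<preceq> 0 \<longleftrightarrow> a = 0"
  using expo_le_antisym[of a 0] by auto

lemma expo_le_add [simp]: "a \<preceq> a + b" "a \<preceq> b + a"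
  by (simp_all add: expo_le_def lookup_add)

lemma expo_le_add_diff: "a \<preceq> b \<Longrightarrow> a + (b - a) = b"
  unfolding expo_le_def by (intro poly_mapping_eqI) (simp add: lookup_add lookup_minus)

lemma expo_eq_add_iff: "a \<preceq> e \<Longrightarrow> e = a + b \<longleftrightarrow> b = e - a"
  by (metis expo_le_add_diff add_diff_cancel_left')

lemma total_degree_add: "total_degree (a + b) = total_degree a + total_degree b"
  by (simp add: total_degree_def lookup_add sum.distrib)

lemma total_degree_strict_mono:
  assumes "a \<preceq> b" "a \<noteq> b" shows "total_degree a < total_degree b"
proof -
  obtain v where "lookup a v \<noteq> lookup b v"
    using assms(2) by (meson poly_mapping_eqI)
  then have "lookup a v < lookup b v" using assms(1) by (simp add: expo_le_def le_neq_implies_less)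
  then show ?thesis using assms(1) unfolding total_degree_def expo_le_def
    by (intro sum_strict_mono_ex1) auto
qed

lemma finite_expo_le: "finite {a :: 'n::finite expo. a \<preceq> b}"
proof -
  have "Poly_Mapping.lookup ` {a. a \<preceq> b} \<subseteq> (\<Pi>\<^sub>E v\<in>UNIV. {..lookup b v})"
    by (auto simp: expo_le_def)
  then have "finite (Poly_Mapping.lookup ` {a. a \<preceq> b})"
    by (rule finite_subset) (simp add: finite_PiE)
  then show ?thesis
    by (rule finite_imageD) (simp add: inj_on_def poly_mapping.lookup_inject)
qed

lemma lookup_single_mult:
  fixes f :: "('n, 'k::field) pol"
  shows "lookup (single a c * f) e = (if a \<preceq> e then c * lookup f (e - a) else 0)"
proof -
  have "lookup (single a c * f) e = c * (Sum_any (\<lambda>b. lookup f b when e = a + b))"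
    by (simp add: lookup_mult lookup_single when_mult)
  also have "\<dots> = (if a \<preceq> e then c * lookup f (e - a) else 0)"
  proof (cases "a \<preceq> e")
    case True then show ?thesis by (simp add: expo_eq_add_iff)
  next
    case False
    then have "e \<noteq> a + b" for b by auto
    then show ?thesis using False by simp
  qed
  finally show ?thesis .
qed

lemma pol_eq_sum_single: "f = (\<Sum>a\<in>keys f. single a (lookup f a))"
  by (rule poly_mapping_eqI)
    (simp add: lookup_sum lookup_single when_def in_keys_iff sum.delta')

lemma lookup_mult_eq_sum:
  fixes f g :: "('n, 'k::field) pol"
  shows "lookup (f * g) b = (\<Sum>a\<in>keys f. if a \<preceq> b then lookup f a * lookup g (b - a) else 0)"
proof -
  have "f * g = (\<Sum>a\<in>keys f. single a (lookup f a) * g)"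
    by (subst pol_eq_sum_single[of f]) (rule sum_distrib_right)
  then show ?thesis by (simp add: lookup_sum lookup_single_mult)
qed

lemma lookup_mult_zero:
  fixes f g :: "('n, 'k::field) pol"
  shows "lookup (f * g) 0 = lookup f 0 * lookup g 0"
proof -
  have "lookup (f * g) 0 = (\<Sum>a\<in>keys f. if a = 0 then lookup f 0 * lookup g 0 else 0)"
    unfolding lookup_mult_eq_sum by (intro sum.cong) auto
  also have "\<dots> = lookup f 0 * lookup g 0"
    by (simp add: sum.delta in_keys_iff)
  finally show ?thesis .
qed

section \<open>Monomial ideals as up-sets of exponents\<close>

lemma module_ring: "Modules.module ((*) :: 'r::comm_ring_1 \<Rightarrow> 'r \<Rightarrow> 'r)"
  by unfold_locales (simp_all add: algebra_simps)

definition upset :: "'n expo set \<Rightarrow> 'n expo set" where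
  "upset A = {b. \<exists>a\<in>A. a \<preceq> b}"

text \<open>
  A monomial ideal contains a polynomial iff it contains each of its monomials, so the ideal is known once its
  up-set of exponents is known.
\<close>

lemma ideal_generated_monomials:
  fixes A :: "'n expo set"
  shows "(f :: ('n, 'k::field) pol) \<in> ideal_generated (monomial ` A) \<longleftrightarrow> keys f \<subseteq> upset A"
proof -
  interpret R: Modules.module "(*) :: ('n, 'k) pol \<Rightarrow> ('n, 'k) pol \<Rightarrow> ('n, 'k) pol" by (rule module_ring)
  have sub: "R.subspace {f :: ('n, 'k) pol. keys f \<subseteq> upset A}"
  proof (rule R.subspaceI, goal_cases)
    case 1 then show ?case by simp
  next
    case (2 f g) then show ?case using Poly_Mapping.keys_add[of f g] by auto
  next
    case (3 c f)
    then show ?case using keys_mult[of c f] expo_le_trans[OF _ expo_le_add(2)]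
      by (fastforce simp: upset_def)
  qed
  show ?thesis
  proof
    assume "f \<in> ideal_generated (monomial ` A)"
    then show "keys f \<subseteq> upset A"
      unfolding ideal_generated_def
    proof (rule R.span_induct[OF _ sub])
      fix x assume "x \<in> monomial ` A"
      then show "keys x \<subseteq> upset A"
        by (auto simp: monomial_def upset_def split: if_splits intro: expo_le_refl)
    qed
  next
    assume k: "keys f \<subseteq> upset A"
    have "(\<Sum>b\<in>keys f. single b (lookup f b)) \<in> R.span (monomial ` A)"
    proof (rule R.span_sum)
      fix b assume "b \<in> keys f"
      then obtain a where a: "a \<in> A" "a \<preceq> b" using k by (auto simp: upset_def)
      have "single b (lookup f b) = single (b - a) (lookup f b) * monomial a"
        using expo_le_add_diff[OF a(2)] by (simp add: monomial_def mult_single add.commute)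
      then show "single b (lookup f b) \<in> R.span (monomial ` A)"
        using a R.span_scale[OF R.span_base] by auto
    qed
    then show "f \<in> ideal_generated (monomial ` A)"
      unfolding ideal_generated_def using pol_eq_sum_single[of f] by simp
  qed
qed

lemma ideal_generated_monomials_eq_iff:
  "ideal_generated (monomial ` A) = (ideal_generated (monomial ` B) :: ('n, 'k::field) pol set)
    \<longleftrightarrow> upset A = upset B"
proof
  assume eq: "ideal_generated (monomial ` A) = (ideal_generated (monomial ` B) :: ('n, 'k) pol set)"
  have "b \<in> upset A \<longleftrightarrow> b \<in> upset B" for b
    using arg_cong[OF eq, of "\<lambda>J. single b 1 \<in> J"] by (simp add: ideal_generated_monomials)
  then show "upset A = upset B" by blast
next
  assume "upset A = upset B"
  then show "ideal_generated (monomial ` A) = (ideal_generated (monomial ` B) :: ('n, 'k) pol set)"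
    by (auto simp: ideal_generated_monomials)
qed

lemma ideal_generated_monomials_closed:
  fixes f g :: "('n, 'k::field) pol"
  assumes I: "I = ideal_generated (monomial ` S)"
  shows "f \<in> I \<Longrightarrow> g \<in> I \<Longrightarrow> f + g \<in> I"
    "f \<in> I \<Longrightarrow> g * f \<in> I" "(\<And>k. k \<in> X \<Longrightarrow> h k \<in> I) \<Longrightarrow> sum h X \<in> I"
proof -
  interpret R: Modules.module "(*) :: ('n, 'k) pol \<Rightarrow> ('n, 'k) pol \<Rightarrow> ('n, 'k) pol" by (rule module_ring)
  show "f \<in> I \<Longrightarrow> g \<in> I \<Longrightarrow> f + g \<in> I"
    "f \<in> I \<Longrightarrow> g * f \<in> I" "(\<And>k. k \<in> X \<Longrightarrow> h k \<in> I) \<Longrightarrow> sum h X \<in> I"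
    unfolding I ideal_generated_def
    by (simp_all add: R.span_add R.span_scale R.span_sum)
qed

lemma irrelevant_ideal_iff:
  "(f :: ('n::finite, 'k::field) pol) \<in> irrelevant_ideal \<longleftrightarrow> lookup f 0 = 0"
proof -
  have "b \<in> upset (range (\<lambda>v. single v 1)) \<longleftrightarrow> b \<noteq> 0" for b :: "'n expo"
  proof
    assume "b \<in> upset (range (\<lambda>v. single v 1))"
    then obtain v where "single v 1 \<preceq> b" by (auto simp: upset_def)
    then have "lookup (single v 1) v \<le> lookup b v" unfolding expo_le_def by blast
    then show "b \<noteq> 0" by auto
  next
    assume "b \<noteq> 0"
    then obtain v where "lookup b v \<noteq> 0" by (metis poly_mapping_eqI lookup_zero)
    then have "single v 1 \<preceq> b" by (auto simp: expo_le_def lookup_single when_def)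
    then show "b \<in> upset (range (\<lambda>v. single v 1))" by (auto simp: upset_def)
  qed
  then have "f \<in> irrelevant_ideal \<longleftrightarrow> keys f \<subseteq> {b. b \<noteq> 0}"
    unfolding irrelevant_ideal_def
    using ideal_generated_monomials[of f "range (\<lambda>v. single v 1)"] by (auto simp: image_image)
  then show ?thesis by (auto simp: in_keys_iff)
qed

section \<open>Dickson's lemma and minimal generators\<close>

text \<open>
  Every sequence has a monotone subsequence; a decreasing one is eventually constant, because \<open>\<nat>\<close> is
  well-founded.
\<close>

lemma nat_seq_mono_subseq:
  fixes s :: "nat \<Rightarrow> nat"
  obtains r :: "nat \<Rightarrow> nat" where "strict_mono r" "mono (\<lambda>n. s (r n))"
proof -
  obtain f :: "nat \<Rightarrow> nat" where f: "strict_mono f" "monoseq (\<lambda>n. s (f n))" using seq_monosub by blast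
  show ?thesis
  proof (cases "incseq (\<lambda>n. s (f n))")
    case True then show ?thesis using that f by blast
  next
    case False
    then have dec: "decseq (\<lambda>n. s (f n))" using f by (simp add: monoseq_iff)
    define N where "N = arg_min (\<lambda>n. s (f n)) (\<lambda>_. True)"
    have N: "s (f N) \<le> s (f n)" for n unfolding N_def
      using arg_min_nat_le[of "\<lambda>_. True" n "\<lambda>n. s (f n)"] by simp
    have "s (f (n + N)) = s (f N)" for n
      using N[of "n + N"] dec by (auto simp: decseq_def intro: le_antisym)
    then show ?thesis using that[of "\<lambda>n. f (n + N)"] f(1)
      by (auto simp: strict_mono_def monotone_def)
  qed
qed

lemma expo_seq_mono_subseq:
  fixes s :: "nat \<Rightarrow> 'n::finite expo"
  assumes "finite V"
  shows "\<exists>r :: nat \<Rightarrow> nat. strict_mono r \<and> (\<forall>v\<in>V. mono (\<lambda>n. lookup (s (r n)) v))"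
  using assms
proof (induction V)
  case empty then show ?case using strict_mono_id by blast
next
  case (insert w V)
  then obtain r :: "nat \<Rightarrow> nat" where r: "strict_mono r" "\<forall>v\<in>V. mono (\<lambda>n. lookup (s (r n)) v)" by blast
  obtain q :: "nat \<Rightarrow> nat" where q: "strict_mono q" "mono (\<lambda>n. lookup (s (r (q n))) w)"
    using nat_seq_mono_subseq[of "\<lambda>n. lookup (s (r n)) w"] by blast
  have "mono (\<lambda>n. lookup (s (r (q n))) v)" if "v \<in> V" for v
    using r(2) that q(1) by (simp add: monotone_def strict_mono_less_eq)
  then show ?case using r(1) q by (intro exI[of _ "\<lambda>n. r (q n)"]) (auto simp: strict_mono_def)
qed

text \<open>
  Dickson's lemma: an infinite set would contain an injective sequence, and passing to a subsequence for one
  coordinate after the other makes it nondecreasing in all of them.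
\<close>

lemma antichain_finite:
  fixes M :: "'n::finite expo set"
  assumes anti: "\<And>a b. a \<in> M \<Longrightarrow> b \<in> M \<Longrightarrow> a \<preceq> b \<Longrightarrow> a = b"
  shows "finite M"
proof (rule ccontr)
  assume "infinite M"
  then obtain s :: "nat \<Rightarrow> 'n expo" where s: "inj s" "range s \<subseteq> M"
    using infinite_countable_subset by blast
  obtain r :: "nat \<Rightarrow> nat" where r: "strict_mono r" "\<forall>v\<in>UNIV. mono (\<lambda>n. lookup (s (r n)) v)"
    using expo_seq_mono_subseq[OF finite_UNIV] by blast
  have "s (r 0) \<preceq> s (r 1)" using r(2) by (simp add: expo_le_def monotone_def)
  then have "s (r 0) = s (r 1)" using anti s(2) by blast
  then have "r 0 = r 1" using s(1) by (simp add: inj_eq)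
  then show False using r(1) by (simp add: strict_mono_eq)
qed

definition min_elems :: "'n expo set \<Rightarrow> 'n expo set" where
  "min_elems U = {a \<in> U. \<forall>b\<in>U. b \<preceq> a \<longrightarrow> b = a}"

lemma min_elems_below:
  fixes U :: "'n::finite expo set"
  assumes "b \<in> U" obtains a where "a \<in> min_elems U" "a \<preceq> b"
proof -
  define a where "a = arg_min total_degree (\<lambda>a. a \<in> U \<and> a \<preceq> b)"
  have a: "a \<in> U" "a \<preceq> b"
    using arg_min_natI[of "\<lambda>a. a \<in> U \<and> a \<preceq> b" b total_degree] assms by (auto simp: a_def)
  have "c = a" if "c \<in> U" "c \<preceq> a" for c
  proof (rule ccontr)
    assume "c \<noteq> a"
    then have "total_degree c < total_degree a" using that total_degree_strict_mono by blast
    moreover have "total_degree a \<le> total_degree c"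
      unfolding a_def using that a expo_le_trans by (intro arg_min_nat_le) blast
    ultimately show False by simp
  qed
  then show ?thesis using a that by (auto simp: min_elems_def)
qed

lemma finite_min_elems: "finite (min_elems (U :: 'n::finite expo set))"
  by (rule antichain_finite) (auto simp: min_elems_def)

lemma upset_min_elems: "upset (min_elems (upset A)) = upset (A :: 'n::finite expo set)"
proof
  show "upset (min_elems (upset A)) \<subseteq> upset A"
    using expo_le_trans unfolding upset_def min_elems_def by blast
  show "upset A \<subseteq> upset (min_elems (upset A))"
    using min_elems_below unfolding upset_def[of "min_elems _"] by blast
qed

lemma irredundant_eq_min_elems:
  fixes A :: "'n::finite expo set"
  assumes "\<And>A'. A' \<subset> A \<Longrightarrow> upset A' \<noteq> upset A"
  shows "A = min_elems (upset A)"
proof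
  have sub: "min_elems (upset A) \<subseteq> A"
    unfolding min_elems_def upset_def using expo_le_refl by blast
  then show "min_elems (upset A) \<subseteq> A" .
  show "A \<subseteq> min_elems (upset A)"
    using assms[of "min_elems (upset A)"] sub upset_min_elems[of A] by blast
qed

text \<open>
  A generating set of monomials is irredundant iff it consists of the minimal elements of the up-set of \<open>I\<close>.
  Hence the description of \<open>min_gens\<close> is satisfied by exactly one set.
\<close>

lemma min_gens_monomial_ideal:
  fixes I :: "('n::finite, 'k::field) pol set"
  assumes "monomial_ideal I"
  shows "finite (min_gens I)" "I = ideal_generated (monomial ` min_gens I)"
proof -
  obtain A where A: "I = ideal_generated (monomial ` A)"
    using assms by (auto simp: monomial_ideal_def monomial_generators_def)
  have gen: "monomial_generators B I \<longleftrightarrow> upset B = upset A" for B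
    unfolding monomial_generators_def A ideal_generated_monomials_eq_iff by blast
  have min: "upset A' \<noteq> upset A" if "A' \<subset> min_elems (upset A)" for A'
  proof
    assume eq: "upset A' = upset A"
    obtain m where m: "m \<in> min_elems (upset A)" "m \<notin> A'" using \<open>A' \<subset> _\<close> by blast
    then have "m \<in> upset A'" using eq by (simp add: min_elems_def)
    then obtain a where a: "a \<in> A'" "a \<preceq> m" by (auto simp: upset_def)
    then have "a \<in> upset A" using eq unfolding upset_def using expo_le_refl by blast
    then show False using a m by (auto simp: min_elems_def)
  qed
  have "min_gens I = min_elems (upset A)"
    unfolding min_gens_def gen
  proof (rule the_equality)
    show "upset (min_elems (upset A)) = upset A \<and>
      (\<forall>A'. A' \<subset> min_elems (upset A) \<longrightarrow> upset A' \<noteq> upset A)"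
      using min upset_min_elems by blast
  next
    fix B assume "upset B = upset A \<and> (\<forall>A'. A' \<subset> B \<longrightarrow> upset A' \<noteq> upset A)"
    then show "B = min_elems (upset A)" using irredundant_eq_min_elems[of B] by metis
  qed
  then show "finite (min_gens I)" "I = ideal_generated (monomial ` min_gens I)"
    using finite_min_elems upset_min_elems[of A] gen[of "min_gens I"]
    by (auto simp: monomial_generators_def)
qed


section \<open>Homogeneous components and graded matrices\<close>

definition homogeneous_component :: "int \<Rightarrow> ('n::finite, 'k::field) pol \<Rightarrow> ('n, 'k) pol" where
  "homogeneous_component d f = Abs_poly_mapping (\<lambda>a. lookup f a when int (total_degree a) = d)"

lemma lookup_homogeneous_component:
  "lookup (homogeneous_component d f) a = (if int (total_degree a) = d then lookup f a else 0)"
proof -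
  have "finite {a. (lookup f a when int (total_degree a) = d) \<noteq> 0}"
    by (rule finite_subset[OF _ finite_keys[of f]]) (auto simp: in_keys_iff when_def)
  then show ?thesis by (simp add: homogeneous_component_def when_def)
qed

lemma homogeneous_homogeneous_component: "homogeneous_of_degree d (homogeneous_component d f)"
  by (auto simp: homogeneous_of_degree_def in_keys_iff lookup_homogeneous_component split: if_splits)

lemma homogeneous_component_eq_self: "homogeneous_of_degree d f \<Longrightarrow> homogeneous_component d f = f"
  by (rule poly_mapping_eqI) (auto simp: homogeneous_of_degree_def in_keys_iff lookup_homogeneous_component)

lemma homogeneous_component_diff: "homogeneous_component d (f - g) = homogeneous_component d f - homogeneous_component d g"
  by (rule poly_mapping_eqI) (simp add: lookup_homogeneous_component lookup_minus)

lemma homogeneous_component_sum: "homogeneous_component d (sum f X) = (\<Sum>i\<in>X. homogeneous_component d (f i))"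
  by (rule poly_mapping_eqI) (simp add: lookup_homogeneous_component lookup_sum)

lemma homogeneous_component_mult:
  assumes "homogeneous_of_degree e g"
  shows "homogeneous_component d (g * f) = g * homogeneous_component (d - e) f"
proof (rule poly_mapping_eqI)
  fix b
  have "int (total_degree (b - a)) = d - e \<longleftrightarrow> int (total_degree b) = d"
    if "a \<in> keys g" "a \<preceq> b" for a
    using total_degree_add[of a "b - a"] expo_le_add_diff[OF that(2)] assms that(1)
    by (auto simp: homogeneous_of_degree_def)
  then have "lookup (g * homogeneous_component (d - e) f) b =
      (\<Sum>a\<in>keys g. if int (total_degree b) = d then
        (if a \<preceq> b then lookup g a * lookup f (b - a) else 0) else 0)"
    unfolding lookup_mult_eq_sum lookup_homogeneous_component by (intro sum.cong) auto
  then show "lookup (homogeneous_component d (g * f)) b = lookup (g * homogeneous_component (d - e) f) b"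
    unfolding lookup_homogeneous_component lookup_mult_eq_sum[of g f] by simp
qed

lemma homogeneous_mult:
  assumes "homogeneous_of_degree d f" "homogeneous_of_degree e g"
  shows "homogeneous_of_degree (d + e) (f * g)"
  using homogeneous_homogeneous_component[of "d + e" "f * g"] homogeneous_component_mult[OF assms(1), of "d + e" g]
    homogeneous_component_eq_self[OF assms(2)] by simp

lemma homogeneous_sum:
  assumes "\<And>i. i \<in> X \<Longrightarrow> homogeneous_of_degree d (f i)"
  shows "homogeneous_of_degree d (sum f X)"
  using homogeneous_homogeneous_component[of d "sum f X"] assms by (simp add: homogeneous_component_sum homogeneous_component_eq_self)

lemma homogeneous_component_in_monomial_ideal:
  assumes "I = ideal_generated (monomial ` S)" "f \<in> I"
  shows "homogeneous_component d f \<in> I"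
proof -
  have "keys (homogeneous_component d f) \<subseteq> keys f" by (auto simp: in_keys_iff lookup_homogeneous_component split: if_splits)
  then show ?thesis using assms by (auto simp: ideal_generated_monomials)
qed

definition graded_mat :: "int list \<Rightarrow> int list \<Rightarrow> ('n::finite, 'k::field) pol mat \<Rightarrow> bool" where
  "graded_mat r c M \<longleftrightarrow> M \<in> carrier_mat (length r) (length c) \<and>
    (\<forall>j < length r. \<forall>k < length c. homogeneous_of_degree (c ! k - r ! j) (M $$ (j, k)))"

lemma graded_mat_carrier: "graded_mat r c M \<Longrightarrow> M \<in> carrier_mat (length r) (length c)"
  by (simp add: graded_mat_def)

lemma graded_mat_mult:
  assumes M: "graded_mat r c M" and N: "graded_mat c d N"
  shows "graded_mat r d (M * N)"
proof -
  have "homogeneous_of_degree (d ! k - r ! j) ((M * N) $$ (j, k))"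
    if jk: "j < length r" "k < length d" for j k
  proof -
    have "homogeneous_of_degree (d ! k - r ! j) (M $$ (j, l) * N $$ (l, k))" if "l < length c" for l
      using homogeneous_mult[of "c ! l - r ! j" "M $$ (j, l)" "d ! k - c ! l" "N $$ (l, k)"] that jk M N
      by (simp add: graded_mat_def)
    then have "homogeneous_of_degree (d ! k - r ! j) (\<Sum>l = 0..<length c. M $$ (j, l) * N $$ (l, k))"
      by (intro homogeneous_sum) simp
    then show ?thesis
      using graded_mat_carrier[OF M] graded_mat_carrier[OF N] jk by (simp add: scalar_prod_def)
  qed
  then show ?thesis
    using graded_mat_carrier[OF M] graded_mat_carrier[OF N] by (simp add: graded_mat_def)
qed

text \<open>
  A preimage under a graded map of a homogeneous element may be replaced by its component of the right degree.
\<close>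

lemma graded_preimage:
  assumes M: "graded_mat r c M"
    and v: "v \<in> carrier_vec (length r)" "\<And>j. j < length r \<Longrightarrow> homogeneous_of_degree (d - r ! j) (v $ j)"
    and w: "w \<in> carrier_vec (length c)" "M *\<^sub>v w = v"
  shows "\<exists>w' \<in> carrier_vec (length c). M *\<^sub>v w' = v \<and>
    (\<forall>k < length c. homogeneous_of_degree (d - c ! k) (w' $ k))"
proof (intro bexI conjI allI impI)
  let ?w = "vec (length c) (\<lambda>k. homogeneous_component (d - c ! k) (w $ k))"
  show "homogeneous_of_degree (d - c ! k) (?w $ k)" if "k < length c" for k
    using that by (simp add: homogeneous_homogeneous_component)
  show "?w \<in> carrier_vec (length c)" by simp
  have entry: "(M *\<^sub>v u) $ j = (\<Sum>k = 0..<length c. M $$ (j, k) * u $ k)"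
    if "j < length r" "u \<in> carrier_vec (length c)" for j u
    using that graded_mat_carrier[OF M] by (simp add: scalar_prod_def)
  show "M *\<^sub>v ?w = v"
  proof (rule eq_vecI)
    show "dim_vec (M *\<^sub>v ?w) = dim_vec v" using graded_mat_carrier[OF M] v by simp
    fix j assume "j < dim_vec v"
    then have j: "j < length r" using v by simp
    have "v $ j = homogeneous_component (d - r ! j) ((M *\<^sub>v w) $ j)"
      using v(2)[OF j] by (simp add: w homogeneous_component_eq_self)
    also have "\<dots> = (\<Sum>k = 0..<length c. homogeneous_component (d - r ! j) (M $$ (j, k) * w $ k))"
      by (simp add: entry[OF j w(1)] homogeneous_component_sum)
    also have "\<dots> = (\<Sum>k = 0..<length c. M $$ (j, k) * homogeneous_component (d - c ! k) (w $ k))"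
      using M j homogeneous_component_mult[of "c ! k - r ! j" "M $$ (j, k)" "d - r ! j" "w $ k" for k]
      by (intro sum.cong refl) (simp add: graded_mat_def)
    also have "\<dots> = (M *\<^sub>v ?w) $ j" by (simp add: entry[OF j])
    finally show "(M *\<^sub>v ?w) $ j = v $ j" by simp
  qed
qed

lemma mat_from_columns:
  assumes M: "M \<in> carrier_mat n m" and N: "N \<in> carrier_mat n l"
    and w: "\<And>k. k < l \<Longrightarrow> \<exists>w \<in> carrier_vec m. M *\<^sub>v w = col N k \<and> P k w"
  shows "\<exists>X \<in> carrier_mat m l. M * X = N \<and> (\<forall>k < l. P k (col X k))"
proof -
  obtain w where w: "\<And>k. k < l \<Longrightarrow> w k \<in> carrier_vec m \<and> M *\<^sub>v w k = col N k \<and> P k (w k)"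
    using w by metis
  define X where "X = mat m l (\<lambda>(j, k). w k $ j)"
  have X: "X \<in> carrier_mat m l" by (simp add: X_def)
  have col: "col X k = w k" if "k < l" for k
    using w[OF that] that by (intro eq_vecI) (auto simp: X_def)
  have "M * X = N"
  proof (rule mat_col_eqI)
    fix k assume "k < dim_col N"
    then have k: "k < l" using N by simp
    show "col (M * X) k = col N k" using w[OF k] by (simp add: col_mult2[OF M X k] col[OF k])
  qed (use M N X in auto)
  then show ?thesis using X col w by (intro bexI[of _ X]) auto
qed

lemma mult_mat_unit_vec:
  fixes M :: "'r::comm_ring_1 mat"
  assumes M: "M \<in> carrier_mat n m" and k: "k < m"
  shows "M *\<^sub>v unit_vec m k = col M k"
  using col_mult2[OF M one_carrier_mat k] M k by simp

section \<open>Comparison of graded free resolutions\<close>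

context
  fixes I :: "('n::finite, 'k::field) pol set" and s \<epsilon> D
  assumes res: "graded_free_resolution I s \<epsilon> D"
begin

lemma resolution_augmentation: "\<epsilon> \<in> carrier_vec (length (s 0))"
  "k < length (s 0) \<Longrightarrow> homogeneous_of_degree (s 0 ! k) (\<epsilon> $ k)"
  "\<exists>v \<in> carrier_vec (length (s 0)). f - \<epsilon> \<bullet> v \<in> I"
  using res unfolding graded_free_resolution_def by auto

lemma resolution_graded_mat: "graded_mat (s i) (s (Suc i)) (D i)"
  using res unfolding graded_free_resolution_def graded_mat_def by auto

lemmas resolution_carrier = resolution_graded_mat[THEN graded_mat_carrier]

lemma resolution_exact_base:
  assumes "v \<in> carrier_vec (length (s 0))"
  shows "\<epsilon> \<bullet> v \<in> I \<longleftrightarrow> (\<exists>w \<in> carrier_vec (length (s 1)). D 0 *\<^sub>v w = v)"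
proof -
  have "{v \<in> carrier_vec (length (s 0)). \<epsilon> \<bullet> v \<in> I} = (\<lambda>w. D 0 *\<^sub>v w) ` carrier_vec (length (s 1))"
    using res unfolding graded_free_resolution_def by blast
  then have "v \<in> {v \<in> carrier_vec (length (s 0)). \<epsilon> \<bullet> v \<in> I} \<longleftrightarrow>
      v \<in> (\<lambda>w. D 0 *\<^sub>v w) ` carrier_vec (length (s 1))" by (rule arg_cong)
  then show ?thesis using assms by auto
qed

lemma resolution_exact:
  assumes "v \<in> carrier_vec (length (s (Suc i)))"
  shows "D i *\<^sub>v v = 0\<^sub>v (length (s i)) \<longleftrightarrow>
    (\<exists>w \<in> carrier_vec (length (s (Suc (Suc i)))). D (Suc i) *\<^sub>v w = v)"
proof -
  have "mat_kernel (D i) = (\<lambda>w. D (Suc i) *\<^sub>v w) ` carrier_vec (length (s (Suc (Suc i))))"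
    using res unfolding graded_free_resolution_def by blast
  then have "v \<in> mat_kernel (D i) \<longleftrightarrow>
      v \<in> (\<lambda>w. D (Suc i) *\<^sub>v w) ` carrier_vec (length (s (Suc (Suc i))))" by (rule arg_cong)
  then show ?thesis using assms unfolding mat_kernel[OF resolution_carrier] by auto
qed

lemma resolution_complex: "D i * D (Suc i) = 0\<^sub>m (length (s i)) (length (s (Suc (Suc i))))"
proof (rule mat_col_eqI)
  fix k assume "k < dim_col (0\<^sub>m (length (s i)) (length (s (Suc (Suc i)))) :: ('n, 'k) pol mat)"
  then have k: "k < length (s (Suc (Suc i)))" by simp
  have "col (D (Suc i)) k = D (Suc i) *\<^sub>v unit_vec (length (s (Suc (Suc i)))) k"
    using mult_mat_unit_vec[OF resolution_carrier k] by simp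
  then have "D i *\<^sub>v col (D (Suc i)) k = 0\<^sub>v (length (s i))"
    using resolution_carrier[of "Suc i"] k
    by (subst resolution_exact) (auto intro!: bexI[of _ "unit_vec (length (s (Suc (Suc i)))) k"])
  then show "col (D i * D (Suc i)) k = col (0\<^sub>m (length (s i)) (length (s (Suc (Suc i))))) k"
    using k by (simp add: col_mult2[OF resolution_carrier resolution_carrier])
qed (use resolution_carrier in auto)

text \<open>
  Exactness, in the form in which chain maps and homotopies are extended by one step.
\<close>

lemma resolution_lift:
  assumes "M \<in> carrier_mat (length (s (Suc i))) l" "D i * M = 0\<^sub>m (length (s i)) l" "k < l"
  shows "\<exists>w \<in> carrier_vec (length (s (Suc (Suc i)))). D (Suc i) *\<^sub>v w = col M k"
proof -
  have "D i *\<^sub>v col M k = 0\<^sub>v (length (s i))"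
    using col_mult2[OF resolution_carrier assms(1,3)] assms by simp
  then show ?thesis using assms by (subst (asm) resolution_exact) auto
qed

lemma graded_lift:
  assumes M: "graded_mat (s i) d M"
    and lift: "\<And>k. k < length d \<Longrightarrow> \<exists>w \<in> carrier_vec (length (s (Suc i))). D i *\<^sub>v w = col M k"
  shows "\<exists>X. graded_mat (s (Suc i)) d X \<and> D i * X = M"
proof -
  have "\<exists>w \<in> carrier_vec (length (s (Suc i))). D i *\<^sub>v w = col M k \<and>
      (\<forall>j < length (s (Suc i)). homogeneous_of_degree (d ! k - s (Suc i) ! j) (w $ j))"
    if k: "k < length d" for k
  proof -
    obtain w where "w \<in> carrier_vec (length (s (Suc i)))" "D i *\<^sub>v w = col M k"
      using lift[OF k] by blast
    then show ?thesis
      using M k by (intro graded_preimage[OF resolution_graded_mat]) (auto simp: graded_mat_def)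
  qed
  from mat_from_columns[OF resolution_carrier graded_mat_carrier[OF M] this]
  obtain X where X: "X \<in> carrier_mat (length (s (Suc i))) (length d)" "D i * X = M"
    "\<forall>k < length d. \<forall>j < length (s (Suc i)). homogeneous_of_degree (d ! k - s (Suc i) ! j) (col X k $ j)"
    by blast
  then have "graded_mat (s (Suc i)) d X" by (simp add: graded_mat_def)
  then show ?thesis using X by blast
qed

end

lemma scalar_prod_mult_mat_vec_eq_sum:
  assumes "x \<in> carrier_vec n" "M \<in> carrier_mat n m" "v \<in> carrier_vec m"
  shows "x \<bullet> (M *\<^sub>v v) = (\<Sum>k = 0..<m. (x \<bullet> col M k) * (v $ k :: 'r::comm_ring_1))"
proof -
  have "x \<bullet> (M *\<^sub>v v) = (\<Sum>j = 0..<n. \<Sum>k = 0..<m. x $ j * M $$ (j, k) * v $ k)"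
    using assms by (simp add: scalar_prod_def sum_distrib_left mult.assoc)
  also have "\<dots> = (\<Sum>k = 0..<m. \<Sum>j = 0..<n. x $ j * M $$ (j, k) * v $ k)"
    by (rule sum.swap)
  also have "\<dots> = (\<Sum>k = 0..<m. (x \<bullet> col M k) * v $ k)"
    using assms by (simp add: scalar_prod_def sum_distrib_right)
  finally show ?thesis .
qed

text \<open>
  Free modules are projective: the identity of \<open>R/I\<close> lifts to a chain map between the two resolutions, column by
  column and one homological degree after the other. Each \<open>\<alpha> i\<close> is kept homogeneous of degree \<open>0\<close>.
  The condition carried through the recursion is that the columns of \<open>\<alpha> i * D i\<close> lie in the image of \<open>E i\<close>, so that
  the next step is possible.
\<close>

lemma comparison_map:
  fixes I :: "('n::finite, 'k::field) pol set"
  assumes I: "I = ideal_generated (monomial ` S)"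
    and F: "graded_free_resolution I s \<epsilon> D" and G: "graded_free_resolution I t \<eta> E"
  shows "\<exists>\<alpha>. (\<forall>i. graded_mat (t i) (s i) (\<alpha> i)) \<and>
    (\<forall>v \<in> carrier_vec (length (s 0)). \<eta> \<bullet> (\<alpha> 0 *\<^sub>v v) - \<epsilon> \<bullet> v \<in> I) \<and>
    (\<forall>i. E i * \<alpha> (Suc i) = \<alpha> i * D i)"
proof -
  note closed = ideal_generated_monomials_closed[OF I]
  let ?base = "\<lambda>a. \<forall>v \<in> carrier_vec (length (s 0)). \<eta> \<bullet> (a *\<^sub>v v) - \<epsilon> \<bullet> v \<in> I"
  let ?P = "\<lambda>i a. graded_mat (t i) (s i) a \<and> (i = 0 \<longrightarrow> ?base a) \<and>
    (\<forall>k < length (s (Suc i)). \<exists>w \<in> carrier_vec (length (t (Suc i))). E i *\<^sub>v w = col (a * D i) k)"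
  note DC = resolution_carrier[OF F] and EC = resolution_carrier[OF G]
  note \<epsilon> = resolution_augmentation[OF F] and \<eta> = resolution_augmentation[OF G]
  have "\<exists>\<alpha>. \<forall>i. ?P i (\<alpha> i) \<and> E i * \<alpha> (Suc i) = \<alpha> i * D i"
  proof (rule dependent_nat_choice)
    have "\<exists>w \<in> carrier_vec (length (t 0)). \<epsilon> $ k - \<eta> \<bullet> w \<in> I \<and>
        (\<forall>j < length (t 0). homogeneous_of_degree (s 0 ! k - t 0 ! j) (w $ j))"
      if k: "k < length (s 0)" for k
    proof -
      obtain w where w: "w \<in> carrier_vec (length (t 0))" "\<epsilon> $ k - \<eta> \<bullet> w \<in> I"
        using \<eta>(3)[of "\<epsilon> $ k"] by blast
      \<comment> \<open>\<open>I\<close> contains the homogeneous components of its elements, so the preimage can be made homogeneous.\<close>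
      let ?w = "vec (length (t 0)) (\<lambda>j. homogeneous_component (s 0 ! k - t 0 ! j) (w $ j))"
      have "homogeneous_component (s 0 ! k) (\<epsilon> $ k - \<eta> \<bullet> w) = \<epsilon> $ k - \<eta> \<bullet> ?w"
        using w(1) \<eta>(1) \<epsilon>(2)[OF k] homogeneous_component_mult[OF \<eta>(2)]
        by (simp add: homogeneous_component_diff homogeneous_component_eq_self scalar_prod_def homogeneous_component_sum)
      then have "\<epsilon> $ k - \<eta> \<bullet> ?w \<in> I" using homogeneous_component_in_monomial_ideal[OF I w(2)] by metis
      then show ?thesis
        by (intro bexI[of _ ?w] conjI allI impI) (simp_all add: homogeneous_homogeneous_component)
    qed
    then obtain w where w: "\<And>k. k < length (s 0) \<Longrightarrow> w k \<in> carrier_vec (length (t 0)) \<and>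
        \<epsilon> $ k - \<eta> \<bullet> w k \<in> I \<and> (\<forall>j < length (t 0). homogeneous_of_degree (s 0 ! k - t 0 ! j) (w k $ j))"
      by metis
    define a where "a = mat (length (t 0)) (length (s 0)) (\<lambda>(j, k). w k $ j)"
    have aC: "a \<in> carrier_mat (length (t 0)) (length (s 0))" by (simp add: a_def)
    have col: "col a k = w k" if "k < length (s 0)" for k
      using w[OF that] that by (intro eq_vecI) (auto simp: a_def)
    have grad: "graded_mat (t 0) (s 0) a" using w by (simp add: graded_mat_def a_def)
    have base: "?base a"
    proof
      fix v :: "('n, 'k) pol vec" assume v: "v \<in> carrier_vec (length (s 0))"
      have "\<eta> \<bullet> (a *\<^sub>v v) - \<epsilon> \<bullet> v = (\<Sum>k = 0..<length (s 0). - v $ k * (\<epsilon> $ k - \<eta> \<bullet> w k))"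
        using v unfolding scalar_prod_mult_mat_vec_eq_sum[OF \<eta>(1) aC v]
        by (simp add: col scalar_prod_def[of \<epsilon>] sum_subtractf[symmetric] algebra_simps)
      then show "\<eta> \<bullet> (a *\<^sub>v v) - \<epsilon> \<bullet> v \<in> I"
        using w by (auto intro!: closed(3) closed(2) simp del: mult_minus_left)
    qed
    have "\<exists>u \<in> carrier_vec (length (t (Suc 0))). E 0 *\<^sub>v u = col (a * D 0) k"
      if k: "k < length (s (Suc 0))" for k
    proof -
      have v: "col (D 0) k \<in> carrier_vec (length (s 0))" using DC[of 0] col_dim[of "D 0" k] by simp
      have "col (D 0) k = D 0 *\<^sub>v unit_vec (length (s (Suc 0))) k"
        using mult_mat_unit_vec[OF DC k] by simp
      then have "\<epsilon> \<bullet> col (D 0) k \<in> I"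
        using resolution_exact_base[OF F v] by auto
      then have "\<eta> \<bullet> (a *\<^sub>v col (D 0) k) \<in> I"
        using base v closed(1) by (metis diff_add_cancel)
      then show ?thesis
        using resolution_exact_base[OF G, of "a *\<^sub>v col (D 0) k"] aC v
        by (simp add: col_mult2[OF aC DC k])
    qed
    then show "\<exists>a. ?P 0 a" using grad base by blast
  next
    fix a i assume P: "?P i a"
    then have a: "graded_mat (t i) (s i) a" and aC: "a \<in> carrier_mat (length (t i)) (length (s i))"
      by (auto simp: graded_mat_carrier)
    obtain b where b: "graded_mat (t (Suc i)) (s (Suc i)) b" "E i * b = a * D i"
      using graded_lift[OF G graded_mat_mult[OF a resolution_graded_mat[OF F]]] P by blast
    have bC: "b \<in> carrier_mat (length (t (Suc i))) (length (s (Suc i)))"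
      using b(1) by (rule graded_mat_carrier)
    have "E i * (b * D (Suc i)) = (a * D i) * D (Suc i)"
      by (simp add: b(2)[symmetric] assoc_mult_mat[OF EC bC DC])
    also have "\<dots> = 0\<^sub>m (length (t i)) (length (s (Suc (Suc i))))"
      by (simp add: assoc_mult_mat[OF aC DC DC] resolution_complex[OF F] right_mult_zero_mat[OF aC])
    finally have "\<exists>w \<in> carrier_vec (length (t (Suc (Suc i)))). E (Suc i) *\<^sub>v w = col (b * D (Suc i)) k"
      if "k < length (s (Suc (Suc i)))" for k
      using resolution_lift[OF G mult_carrier_mat[OF bC DC]] that by blast
    then show "\<exists>b. ?P (Suc i) b \<and> E i * b = a * D i" using b by blast
  qed
  then show ?thesis by blast
qed

text \<open>
  A chain map that is zero on \<open>R/I\<close> is homotopic to zero. What has to be lifted in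
  degree \<open>i + 1\<close> is \<open>\<gamma> (Suc i) - h i * D i\<close>, and \<open>D i\<close> kills it: the product is
  \<open>(\<gamma> i - D i * h i) * D i\<close>, where the first factor is zero or the previous homotopy composed with the
  previous differential.
\<close>

lemma null_homotopy:
  fixes I :: "('n::finite, 'k::field) pol set"
  assumes F: "graded_free_resolution I s \<epsilon> D"
    and \<gamma>: "\<And>i. \<gamma> i \<in> carrier_mat (length (s i)) (length (s i))"
    and base: "\<And>v. v \<in> carrier_vec (length (s 0)) \<Longrightarrow> \<epsilon> \<bullet> (\<gamma> 0 *\<^sub>v v) \<in> I"
    and chain: "\<And>i. D i * \<gamma> (Suc i) = \<gamma> i * D i"
  shows "\<exists>h. (\<forall>i. h i \<in> carrier_mat (length (s (Suc i))) (length (s i))) \<and>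
    D 0 * h 0 = \<gamma> 0 \<and> (\<forall>i. D (Suc i) * h (Suc i) = \<gamma> (Suc i) - h i * D i)"
proof -
  note DC = resolution_carrier[OF F]
  let ?P = "\<lambda>i h. h \<in> carrier_mat (length (s (Suc i))) (length (s i)) \<and> (i = 0 \<longrightarrow> D 0 * h = \<gamma> 0) \<and>
    D i * (\<gamma> (Suc i) - h * D i) = 0\<^sub>m (length (s i)) (length (s (Suc i)))"
  have "\<exists>h. \<forall>i. ?P i (h i) \<and> D (Suc i) * h (Suc i) = \<gamma> (Suc i) - h i * D i"
  proof (rule dependent_nat_choice)
    have "\<exists>w \<in> carrier_vec (length (s (Suc 0))). D 0 *\<^sub>v w = col (\<gamma> 0) k \<and> True" if "k < length (s 0)" for k
    proof -
      have "col (\<gamma> 0) k = \<gamma> 0 *\<^sub>v unit_vec (length (s 0)) k"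
        using mult_mat_unit_vec[OF \<gamma> that] by simp
      then have "\<epsilon> \<bullet> col (\<gamma> 0) k \<in> I" using base by simp
      then show ?thesis using resolution_exact_base[OF F, of "col (\<gamma> 0) k"] \<gamma>[of 0]
          col_dim[of "\<gamma> 0" k] by simp
    qed
    from mat_from_columns[OF DC \<gamma> this] obtain h where
      h: "h \<in> carrier_mat (length (s (Suc 0))) (length (s 0))" "D 0 * h = \<gamma> 0" by blast
    have "D 0 * (\<gamma> (Suc 0) - h * D 0) = D 0 * \<gamma> (Suc 0) - D 0 * (h * D 0)"
      by (rule mult_minus_distrib_mat[OF DC \<gamma> mult_carrier_mat[OF h(1) DC]])
    also have "\<dots> = 0\<^sub>m (length (s 0)) (length (s (Suc 0)))"
      using mult_carrier_mat[OF \<gamma> DC, of 0]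
      by (simp add: assoc_mult_mat[OF DC h(1) DC, symmetric] h(2) chain minus_r_inv_mat)
    finally show "\<exists>h. ?P 0 h" using h by blast
  next
    fix h i assume P: "?P i h"
    let ?r = "\<gamma> (Suc i) - h * D i"
    have hC: "h \<in> carrier_mat (length (s (Suc i))) (length (s i))" using P by blast
    have rC: "?r \<in> carrier_mat (length (s (Suc i))) (length (s (Suc i)))"
      using \<gamma>[of "Suc i"] hC DC[of i] by (intro minus_carrier_mat) auto
    have "\<exists>w \<in> carrier_vec (length (s (Suc (Suc i)))). D (Suc i) *\<^sub>v w = col ?r k \<and> True"
      if "k < length (s (Suc i))" for k
      using resolution_lift[OF F rC _ that] P by blast
    from mat_from_columns[OF DC rC this] obtain g where
      g: "g \<in> carrier_mat (length (s (Suc (Suc i)))) (length (s (Suc i)))" "D (Suc i) * g = ?r" by blast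
    have "D (Suc i) * (\<gamma> (Suc (Suc i)) - g * D (Suc i))
        = D (Suc i) * \<gamma> (Suc (Suc i)) - D (Suc i) * (g * D (Suc i))"
      by (rule mult_minus_distrib_mat[OF DC \<gamma> mult_carrier_mat[OF g(1) DC]])
    also have "\<dots> = \<gamma> (Suc i) * D (Suc i) - ?r * D (Suc i)"
      by (simp add: assoc_mult_mat[OF DC g(1) DC, symmetric] g(2) chain)
    also have "?r * D (Suc i) = \<gamma> (Suc i) * D (Suc i) - h * D i * D (Suc i)"
      by (rule minus_mult_distrib_mat[OF \<gamma> mult_carrier_mat[OF hC DC] DC])
    also have "h * D i * D (Suc i) = 0\<^sub>m (length (s (Suc i))) (length (s (Suc (Suc i))))"
      by (simp add: assoc_mult_mat[OF hC DC DC] resolution_complex[OF F] right_mult_zero_mat[OF hC])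
    also have "\<gamma> (Suc i) * D (Suc i) - (\<gamma> (Suc i) * D (Suc i) - 0\<^sub>m (length (s (Suc i))) (length (s (Suc (Suc i)))))
        = 0\<^sub>m (length (s (Suc i))) (length (s (Suc (Suc i))))"
      using mult_carrier_mat[OF \<gamma> DC, of "Suc i"] by (intro eq_matI) auto
    finally show "\<exists>g. ?P (Suc i) g \<and> D (Suc i) * g = ?r" using g by blast
  qed
  then show ?thesis by blast
qed

text \<open>
  The composite of comparison maps \<open>F \<rightarrow> G \<rightarrow> F\<close> is homotopic to the identity. All differentials of \<open>F\<close> vanish modulo the
  irrelevant ideal, so modulo that ideal the composite is the identity. The diagonal entry for a basis
  element of \<open>F\<close> thus has constant coefficient \<open>1\<close>, which forces a nonzero constant coefficient in some
  entry of \<open>F \<rightarrow> G\<close>; by homogeneity the two basis elements joined by it have the same degree.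
\<close>

theorem minimal_resolution_degrees_subset:
  fixes I :: "('n::finite, 'k::field) pol set"
  assumes I: "I = ideal_generated (monomial ` S)"
    and F: "minimal_graded_free_resolution I s \<epsilon> D" and G: "graded_free_resolution I t \<eta> E"
  shows "set (s i) \<subseteq> set (t i)"
proof
  fix d assume "d \<in> set (s i)"
  then obtain k where k: "k < length (s i)" "d = s i ! k" by (metis in_set_conv_nth)
  have F': "graded_free_resolution I s \<epsilon> D"
    and Dmin: "\<And>i j k. j < length (s i) \<Longrightarrow> k < length (s (Suc i)) \<Longrightarrow> lookup (D i $$ (j, k)) 0 = 0"
    using F by (auto simp: minimal_graded_free_resolution_def irrelevant_ideal_iff)
  note closed = ideal_generated_monomials_closed[OF I]
  note DC = resolution_carrier[OF F'] and EC = resolution_carrier[OF G]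
  obtain \<alpha> where \<alpha>: "\<And>i. graded_mat (t i) (s i) (\<alpha> i)"
    "\<And>v. v \<in> carrier_vec (length (s 0)) \<Longrightarrow> \<eta> \<bullet> (\<alpha> 0 *\<^sub>v v) - \<epsilon> \<bullet> v \<in> I"
    "\<And>i. E i * \<alpha> (Suc i) = \<alpha> i * D i"
    using comparison_map[OF I F' G] by blast
  obtain \<beta> where \<beta>: "\<And>i. graded_mat (s i) (t i) (\<beta> i)"
    "\<And>v. v \<in> carrier_vec (length (t 0)) \<Longrightarrow> \<epsilon> \<bullet> (\<beta> 0 *\<^sub>v v) - \<eta> \<bullet> v \<in> I"
    "\<And>i. D i * \<beta> (Suc i) = \<beta> i * E i"
    using comparison_map[OF I G F'] by blast
  note \<alpha>C = \<alpha>(1)[THEN graded_mat_carrier] and \<beta>C = \<beta>(1)[THEN graded_mat_carrier]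
  note \<beta>\<alpha>C = mult_carrier_mat[OF \<beta>C \<alpha>C]
  define \<gamma> where "\<gamma> i = \<beta> i * \<alpha> i - 1\<^sub>m (length (s i))" for i
  have \<gamma>C: "\<gamma> i \<in> carrier_mat (length (s i)) (length (s i))" for i
    unfolding \<gamma>_def using \<beta>\<alpha>C[of i] by (intro minus_carrier_mat) auto
  have base: "\<epsilon> \<bullet> (\<gamma> 0 *\<^sub>v v) \<in> I" if v: "v \<in> carrier_vec (length (s 0))" for v
  proof -
    have v': "\<alpha> 0 *\<^sub>v v \<in> carrier_vec (length (t 0))" using \<alpha>C[of 0] v by simp
    have "\<gamma> 0 *\<^sub>v v = \<beta> 0 *\<^sub>v (\<alpha> 0 *\<^sub>v v) - v"
      unfolding \<gamma>_def using \<beta>\<alpha>C[of 0] v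
      by (simp add: minus_mult_distrib_mat_vec[of _ "length (s 0)" "length (s 0)"]
          assoc_mult_mat_vec[OF \<beta>C \<alpha>C v])
    then have "\<epsilon> \<bullet> (\<gamma> 0 *\<^sub>v v) = \<epsilon> \<bullet> (\<beta> 0 *\<^sub>v (\<alpha> 0 *\<^sub>v v)) - \<epsilon> \<bullet> v"
      using scalar_prod_minus_distrib[OF resolution_augmentation(1)[OF F'], of "\<beta> 0 *\<^sub>v (\<alpha> 0 *\<^sub>v v)" v]
        \<beta>C[of 0] v v' by simp
    also have "\<dots> = (\<epsilon> \<bullet> (\<beta> 0 *\<^sub>v (\<alpha> 0 *\<^sub>v v)) - \<eta> \<bullet> (\<alpha> 0 *\<^sub>v v)) + (\<eta> \<bullet> (\<alpha> 0 *\<^sub>v v) - \<epsilon> \<bullet> v)"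
      by simp
    also have "\<dots> \<in> I" using \<alpha>(2)[OF v] \<beta>(2)[OF v'] closed(1) by blast
    finally show ?thesis .
  qed
  have chain: "D i * \<gamma> (Suc i) = \<gamma> i * D i" for i
  proof -
    have "D i * \<gamma> (Suc i) = D i * (\<beta> (Suc i) * \<alpha> (Suc i)) - D i * 1\<^sub>m (length (s (Suc i)))"
      unfolding \<gamma>_def by (rule mult_minus_distrib_mat[OF DC \<beta>\<alpha>C one_carrier_mat])
    also have "\<dots> = D i * \<beta> (Suc i) * \<alpha> (Suc i) - D i"
      using DC[of i] by (simp add: assoc_mult_mat[OF DC \<beta>C \<alpha>C])
    also have "\<dots> = \<beta> i * (E i * \<alpha> (Suc i)) - D i"
      by (simp add: \<beta>(3) assoc_mult_mat[OF \<beta>C EC \<alpha>C])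
    also have "\<dots> = \<beta> i * \<alpha> i * D i - 1\<^sub>m (length (s i)) * D i"
      using DC[of i] by (simp add: \<alpha>(3) assoc_mult_mat[OF \<beta>C \<alpha>C DC])
    also have "\<dots> = \<gamma> i * D i"
      unfolding \<gamma>_def by (rule minus_mult_distrib_mat[OF \<beta>\<alpha>C one_carrier_mat DC, symmetric])
    finally show ?thesis .
  qed
  obtain h where hC: "\<And>i. h i \<in> carrier_mat (length (s (Suc i))) (length (s i))"
    and h: "D 0 * h 0 = \<gamma> 0" "\<And>i. D (Suc i) * h (Suc i) = \<gamma> (Suc i) - h i * D i"
    using null_homotopy[OF F' \<gamma>C base chain] by blast
  \<comment> \<open>The homotopy expresses \<open>\<gamma> i\<close> by products with a differential of \<open>F\<close>, which have no constant coefficients.\<close>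
  have Dh: "lookup ((D i * h i) $$ (k, k)) 0 = 0" if "k < length (s i)" for i k
    using DC[of i] hC[of i] that Dmin by (simp add: scalar_prod_def lookup_sum lookup_mult_zero)
  have hD: "lookup ((h i * D i) $$ (k, k)) 0 = 0" if "k < length (s (Suc i))" for i k
    using DC[of i] hC[of i] that Dmin by (simp add: scalar_prod_def lookup_sum lookup_mult_zero)
  have "lookup (\<gamma> i $$ (k, k)) 0 = 0"
  proof (cases i)
    case 0 then show ?thesis using Dh[of k 0] k h(1) by simp
  next
    case (Suc i')
    have "lookup ((\<gamma> (Suc i') - h i' * D i') $$ (k, k)) 0 = 0"
      using Dh[of k i] k(1) h(2)[of i'] unfolding Suc by simp
    then show ?thesis
      using hD[of k i'] k(1) DC[of i'] hC[of i'] unfolding Suc by (simp add: lookup_minus)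
  qed
  then have "lookup ((\<beta> i * \<alpha> i) $$ (k, k)) 0 = 1"
    using k(1) \<alpha>C[of i] \<beta>C[of i] unfolding \<gamma>_def by (simp add: lookup_minus)
  then have "(\<Sum>l = 0..<length (t i). lookup (\<beta> i $$ (k, l)) 0 * lookup (\<alpha> i $$ (l, k)) 0) \<noteq> 0"
    using k(1) \<alpha>C[of i] \<beta>C[of i] by (simp add: scalar_prod_def lookup_sum lookup_mult_zero)
  then obtain l where l: "l < length (t i)" "lookup (\<alpha> i $$ (l, k)) 0 \<noteq> 0"
    by (metis (no_types, lifting) atLeastLessThan_iff mult_zero_right sum.neutral)
  then have "0 \<in> keys (\<alpha> i $$ (l, k))" by (simp add: in_keys_iff)
  then have "s i ! k - t i ! l = int (total_degree (0 :: 'n expo))"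
    using \<alpha>(1)[of i] l(1) k(1) by (auto simp: graded_mat_def homogeneous_of_degree_def)
  then have "d = t i ! l" by (simp add: k(2) total_degree_def)
  then show "d \<in> set (t i)" using l(1) by simp
qed


section \<open>Multigraded resolutions over the ground field\<close>

text \<open>
  Coefficient vectors, over the ground field, of the elements of multidegree \<open>b\<close> in the free module with basis
  degrees \<open>t\<close>. The basis element \<open>k\<close> contributes the monomial \<open>b - t ! k\<close>, provided that \<open>t ! k\<close> divides \<open>b\<close>.
  Vectors are functions on all of \<open>\<nat>\<close>, extended by zero, so that strands of different modules live in one
  vector space.
\<close>

definition strand :: "'n expo list \<Rightarrow> 'n expo \<Rightarrow> (nat \<Rightarrow> 'k::field) set" where
  "strand t b = {u. \<forall>k. u k \<noteq> 0 \<longrightarrow> k < length t \<and> t ! k \<preceq> b}"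

definition mat_fun :: "nat \<Rightarrow> (nat \<Rightarrow> nat \<Rightarrow> 'k::field) \<Rightarrow> (nat \<Rightarrow> 'k) \<Rightarrow> nat \<Rightarrow> 'k" where
  "mat_fun n c u = (\<lambda>j. \<Sum>k<n. c j k * u k)"

text \<open>
  A multigraded free resolution of \<open>R/I\<close>, where \<open>U\<close> is the set of exponents of the monomials of \<open>I\<close>. The last two
  conditions are exactness of the strand at each multidegree \<open>b\<close>. The first of them concerns \<open>F\<^sub>0\<close>: the
  component of degree \<open>b\<close> of \<open>R/I\<close> is zero if \<open>b \<in> U\<close> and the ground field otherwise. The module \<open>F\<^sub>0\<close> is \<open>R\<close>, or zero if
  \<open>I = R\<close>: the second choice is the one that a minimal resolution needs.
\<close>

definition scalar_resolution ::
  "'n expo set \<Rightarrow> (nat \<Rightarrow> 'n expo list) \<Rightarrow> (nat \<Rightarrow> nat \<Rightarrow> nat \<Rightarrow> 'k::field) \<Rightarrow> bool" where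
  "scalar_resolution U t C \<longleftrightarrow>
     (t 0 = [] \<and> 0 \<in> U \<or> t 0 = [0]) \<and>
     (\<forall>i j k. C i j k \<noteq> 0 \<longrightarrow> j < length (t i) \<and> k < length (t (Suc i)) \<and> t i ! j \<preceq> t (Suc i) ! k) \<and>
     (\<forall>b. {u \<in> strand (t 0) b. b \<in> U \<or> u = 0} =
        mat_fun (length (t (Suc 0))) (C 0) ` strand (t (Suc 0)) b) \<and>
     (\<forall>i b. {u \<in> strand (t (Suc i)) b. mat_fun (length (t (Suc i))) (C i) u = 0} =
        mat_fun (length (t (Suc (Suc i)))) (C (Suc i)) ` strand (t (Suc (Suc i))) b)"

definition minimal_scalar_resolution ::
  "'n expo set \<Rightarrow> (nat \<Rightarrow> 'n expo list) \<Rightarrow> (nat \<Rightarrow> nat \<Rightarrow> nat \<Rightarrow> 'k::field) \<Rightarrow> bool" where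
  "minimal_scalar_resolution U t C \<longleftrightarrow> scalar_resolution U t C \<and>
     (\<forall>i j k. C i j k \<noteq> 0 \<longrightarrow> t i ! j \<noteq> t (Suc i) ! k)"

text \<open>
  The scalars and the linear maps between strands do not change at all: a basis element of new degree \<open>\<Phi> a\<close> lies in the
  strand at \<open>b\<close> iff the one of old degree \<open>a\<close> lay in the strand at \<open>\<Psi> b\<close>.
\<close>

lemma scalar_resolution_relabel:
  assumes gal: "\<And>a b. \<Phi> a \<preceq> b \<longleftrightarrow> a \<preceq> \<Psi> b"
    and res: "scalar_resolution (upset A) t (C :: nat \<Rightarrow> nat \<Rightarrow> nat \<Rightarrow> 'k::field)"
  shows "scalar_resolution (upset (\<Phi> ` A)) (\<lambda>i. map \<Phi> (t i)) C"
proof -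
  have mem: "b \<in> upset (\<Phi> ` A) \<longleftrightarrow> \<Psi> b \<in> upset A" for b by (simp add: upset_def gal)
  have zero: "\<Phi> 0 = 0" using gal[of 0 0] by simp
  have zero_mem: "0 \<in> upset (\<Phi> ` A)" if "0 \<in> upset A" using that zero by (force simp: upset_def)
  have mono: "\<Phi> a \<preceq> \<Phi> b" if "a \<preceq> b" for a b
    using gal expo_le_refl expo_le_trans that by blast
  have strand: "(strand (map \<Phi> s) b :: (nat \<Rightarrow> 'k) set) = strand s (\<Psi> b)" for s b
    by (auto simp: strand_def gal)
  show ?thesis
    using res zero zero_mem mono unfolding scalar_resolution_def by (auto simp: strand mem)
qed

interpretation fun_space: vector_space "\<lambda>(a :: 'k::field) (u :: nat \<Rightarrow> 'k) i. a * u i"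
  by unfold_locales (auto simp: fun_eq_iff algebra_simps)

lemma sum_fun_apply: "(\<Sum>i\<in>X. f i) j = (\<Sum>i\<in>X. f i j)"
  by (induction X rule: infinite_finite_induct) auto

lemma fun_subspaceI:
  assumes "0 \<in> S" "\<And>u v. u \<in> S \<Longrightarrow> v \<in> S \<Longrightarrow> u + v \<in> S" "\<And>a u. u \<in> S \<Longrightarrow> (\<lambda>i. a * u i) \<in> S"
  shows "fun_space.subspace S"
  using assms by (intro fun_space.subspaceI) auto

lemma subspace_strand: "fun_space.subspace (strand t b :: (nat \<Rightarrow> 'k::field) set)"
proof (rule fun_subspaceI)
  fix u v :: "nat \<Rightarrow> 'k" assume uv: "u \<in> strand t b" "v \<in> strand t b"
  have "u k \<noteq> 0 \<or> v k \<noteq> 0" if "(u + v) k \<noteq> 0" for k using that by auto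
  then show "u + v \<in> strand t b" using uv unfolding strand_def by blast
qed (auto simp: strand_def)

lemma strand_mono: "a \<preceq> b \<Longrightarrow> strand t a \<subseteq> strand t b"
  unfolding strand_def using expo_le_trans by blast

lemma mat_fun_add: "mat_fun n c (u + v) = mat_fun n c u + mat_fun n c v"
  by (auto simp: mat_fun_def algebra_simps sum.distrib)

lemma mat_fun_scale: "mat_fun n c (\<lambda>i. a * u i) = (\<lambda>i. a * mat_fun n c u i)"
  by (auto simp: mat_fun_def sum_distrib_left mult.left_commute)

lemma mat_fun_zero [simp]: "mat_fun n c 0 = 0"
  by (auto simp: mat_fun_def)

lemma subspace_kernel:
  fixes c :: "nat \<Rightarrow> nat \<Rightarrow> 'k::field"
  shows "fun_space.subspace {u \<in> strand t b. mat_fun n c u = 0}"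
proof (rule fun_subspaceI)
  have S: "fun_space.subspace (strand t b :: (nat \<Rightarrow> 'k) set)" by (rule subspace_strand)
  show "0 \<in> {u \<in> strand t b. mat_fun n c u = 0}"
    using fun_space.subspace_0[OF S] by simp
  show "u + v \<in> {u \<in> strand t b. mat_fun n c u = 0}"
    if "u \<in> {u \<in> strand t b. mat_fun n c u = 0}" "v \<in> {u \<in> strand t b. mat_fun n c u = 0}" for u v
    using that fun_space.subspace_add[OF S] by (simp add: mat_fun_add)
  show "(\<lambda>i. a * u i) \<in> {u \<in> strand t b. mat_fun n c u = 0}"
    if "u \<in> {u \<in> strand t b. mat_fun n c u = 0}" for a u
    using that fun_space.subspace_scale[OF S, of u a] by (auto simp: mat_fun_scale)
qed

lemma subspace_image:
  fixes c :: "nat \<Rightarrow> nat \<Rightarrow> 'k::field"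
  shows "fun_space.subspace (mat_fun n c ` strand t b)"
proof (rule fun_subspaceI)
  have S: "fun_space.subspace (strand t b :: (nat \<Rightarrow> 'k) set)" by (rule subspace_strand)
  show "0 \<in> mat_fun n c ` strand t b"
    using fun_space.subspace_0[OF S] mat_fun_zero by (metis imageI)
  show "u + v \<in> mat_fun n c ` strand t b"
    if "u \<in> mat_fun n c ` strand t b" "v \<in> mat_fun n c ` strand t b" for u v
    using that fun_space.subspace_add[OF S] by (auto simp: mat_fun_add[symmetric])
  show "(\<lambda>i. a * u i) \<in> mat_fun n c ` strand t b" if u: "u \<in> mat_fun n c ` strand t b" for a u
  proof -
    obtain w where "w \<in> strand t b" "u = mat_fun n c w" using u by blast
    then show ?thesis
      using fun_space.subspace_scale[OF S, of w a] mat_fun_scale[of n c a w] by (metis imageI)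
  qed
qed

lemma finite_basis:
  fixes V :: "(nat \<Rightarrow> 'k::field) set"
  assumes V: "\<And>u j. u \<in> V \<Longrightarrow> j \<ge> n \<Longrightarrow> u j = 0"
  obtains B where "finite B" "B \<subseteq> V" "V \<subseteq> fun_space.span B"
proof -
  define e where "e l = (\<lambda>j. if j = l then 1 else 0 :: 'k)" for l :: nat
  have "u \<in> fun_space.span (e ` {..<n})" if "u \<in> V" for u
  proof -
    have "(\<Sum>l<n. (\<lambda>j. u l * e l j)) \<in> fun_space.span (e ` {..<n})"
      by (intro fun_space.span_sum fun_space.span_scale fun_space.span_base) auto
    moreover have "(\<Sum>l<n. (\<lambda>j. u l * e l j)) = u"
    proof
      fix j
      show "(\<Sum>l<n. (\<lambda>j. u l * e l j)) j = u j"
        using V[OF that, of j] by (simp add: sum_fun_apply e_def if_distrib sum.delta cong: if_cong)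
    qed
    ultimately show ?thesis by simp
  qed
  then have sub: "V \<subseteq> fun_space.span (e ` {..<n})" by blast
  obtain B where B: "B \<subseteq> V" "\<not> fun_space.dependent B" "V \<subseteq> fun_space.span B"
    using fun_space.maximal_independent_subset[of V] by blast
  have "finite B"
    using fun_space.independent_span_bound[of "e ` {..<n}" B] B sub by blast
  then show ?thesis using that B by blast
qed

text \<open>
  \<open>K\<close> is a multigraded submodule of a free module, given by its strands. Since it is generated
  in degrees below \<open>m\<close>, bases of its finitely many strands there form a finite generating set. A generating
  set of least cardinality is minimal in the sense of the last conclusion: in a relation of degree \<open>b\<close>, a generator of that same degree \<open>b\<close>
  cannot occur, as it could be expressed by the others.
\<close>

lemma minimal_graded_generators:
  fixes K :: "'n::finite expo \<Rightarrow> (nat \<Rightarrow> 'k::field) set"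
  assumes sub: "\<And>b. fun_space.subspace (K b)"
    and bound: "\<And>b u j. u \<in> K b \<Longrightarrow> j \<ge> n \<Longrightarrow> u j = 0"
    and mono: "\<And>a b. a \<preceq> b \<Longrightarrow> K a \<subseteq> K b"
    and box: "\<And>b u. u \<in> K b \<Longrightarrow> \<exists>a. a \<preceq> m \<and> a \<preceq> b \<and> u \<in> K a"
  shows "\<exists>t c. (\<forall>k < length t. t ! k \<preceq> m \<and> (\<lambda>j. c j k) \<in> K (t ! k)) \<and>
    (\<forall>j k. k \<ge> length t \<longrightarrow> c j k = 0) \<and>
    (\<forall>b. K b = mat_fun (length t) c ` strand t b) \<and>
    (\<forall>b u k. u \<in> strand t b \<longrightarrow> mat_fun (length t) c u = 0 \<longrightarrow> k < length t \<longrightarrow> t ! k = b \<longrightarrow> u k = 0)"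
proof -
  define gen where "gen Z \<longleftrightarrow> finite Z \<and> (\<forall>z \<in> Z. fst z \<preceq> m \<and> snd z \<in> K (fst z)) \<and>
    (\<forall>b. K b \<subseteq> fun_space.span (snd ` {z \<in> Z. fst z \<preceq> b}))" for Z
  have "\<exists>Z. gen Z"
  proof -
    have "\<exists>B. finite B \<and> B \<subseteq> K d \<and> K d \<subseteq> fun_space.span B" for d
      using finite_basis[of "K d" n] bound by metis
    then obtain B where B: "\<And>d. finite (B d) \<and> B d \<subseteq> K d \<and> K d \<subseteq> fun_space.span (B d)" by metis
    have "gen (SIGMA d:{d. d \<preceq> m}. B d)"
      unfolding gen_def
    proof (intro conjI allI)
      show "finite (SIGMA d:{d. d \<preceq> m}. B d)" using B by (intro finite_SigmaI finite_expo_le) auto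
      show "\<forall>z \<in> SIGMA d:{d. d \<preceq> m}. B d. fst z \<preceq> m \<and> snd z \<in> K (fst z)" using B by auto
      fix b show "K b \<subseteq> fun_space.span (snd ` {z \<in> SIGMA d:{d. d \<preceq> m}. B d. fst z \<preceq> b})"
      proof
        fix u assume "u \<in> K b"
        then obtain a where a: "a \<preceq> m" "a \<preceq> b" "u \<in> K a" using box by blast
        have "B a \<subseteq> snd ` {z \<in> SIGMA d:{d. d \<preceq> m}. B d. fst z \<preceq> b}" using a by force
        then show "u \<in> fun_space.span (snd ` {z \<in> SIGMA d:{d. d \<preceq> m}. B d. fst z \<preceq> b})"
          using a(3) B fun_space.span_mono by blast
      qed
    qed
    then show ?thesis by blast
  qed
  then obtain Z0 where Z0: "gen Z0" by blast
  define Z where "Z = arg_min card gen"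
  have Z: "gen Z" unfolding Z_def using Z0 by (rule arg_min_natI)
  have min: "card Z \<le> card Z'" if "gen Z'" for Z'
    unfolding Z_def using that by (rule arg_min_nat_le)
  have "finite Z" using Z by (simp add: gen_def)
  then obtain zs where zs: "set zs = Z" "distinct zs" using finite_distinct_list by blast
  define t where "t = map fst zs"
  define c where "c j k = (if k < length zs then snd (zs ! k) j else 0)" for j k
  have len: "length t = length zs" by (simp add: t_def)
  have nth: "t ! k \<preceq> m" "snd (zs ! k) \<in> K (t ! k)" if "k < length zs" for k
    using Z zs(1) that unfolding gen_def t_def by auto
  have image: "mat_fun (length t) c u = (\<Sum>k<length zs. (\<lambda>j. u k * snd (zs ! k) j))" for u
    by (auto simp: fun_eq_iff mat_fun_def len c_def sum_fun_apply mult.commute intro!: sum.cong)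
  show ?thesis
  proof (intro exI conjI allI impI)
    fix k assume "k < length t"
    then show "t ! k \<preceq> m" "(\<lambda>j. c j k) \<in> K (t ! k)" using nth[of k] by (simp_all add: len c_def)
  next
    fix j k assume "k \<ge> length t" then show "c j k = 0" by (simp add: len c_def)
  next
    fix b
    show "K b = mat_fun (length t) c ` strand t b"
    proof
      have "snd ` {z \<in> Z. fst z \<preceq> b} \<subseteq> mat_fun (length t) c ` strand t b"
      proof clarify
        fix d v assume "(d, v) \<in> Z" "fst (d, v) \<preceq> b"
        then obtain k where k: "k < length zs" "zs ! k = (d, v)" "d \<preceq> b"
          using zs(1) by (auto simp: in_set_conv_nth)
        have "mat_fun (length t) c (\<lambda>l. if l = k then 1 else 0) = v"
          using k by (auto simp: fun_eq_iff mat_fun_def len c_def if_distrib sum.delta cong: if_cong)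
        moreover have "(\<lambda>l. if l = k then 1 else 0) \<in> strand t b"
          using k by (auto simp: strand_def len t_def)
        ultimately show "snd (d, v) \<in> mat_fun (length t) c ` strand t b" by force
      qed
      then show "K b \<subseteq> mat_fun (length t) c ` strand t b"
        using fun_space.span_minimal[OF _ subspace_image] Z unfolding gen_def by blast
      show "mat_fun (length t) c ` strand t b \<subseteq> K b"
      proof clarify
        fix u :: "nat \<Rightarrow> 'k" assume u: "u \<in> strand t b"
        have "(\<lambda>j. u k * snd (zs ! k) j) \<in> K b" if k: "k < length zs" for k
        proof (cases "u k = 0")
          case True
          then show ?thesis using fun_space.subspace_0[OF sub[of b]] by (simp add: zero_fun_def)
        next
          case False
          then have "snd (zs ! k) \<in> K b" using u nth(2)[OF k] mono by (auto simp: strand_def)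
          then show ?thesis using fun_space.subspace_scale[OF sub] by blast
        qed
        then show "mat_fun (length t) c u \<in> K b"
          unfolding image by (intro fun_space.subspace_sum[OF sub]) auto
      qed
    qed
  next
    fix b k and u :: "nat \<Rightarrow> 'k"
    assume u: "u \<in> strand t b" "mat_fun (length t) c u = 0" and k: "k < length t" "t ! k = b"
    show "u k = 0"
    proof (rule ccontr)
      assume uk: "u k \<noteq> 0"
      let ?z = "zs ! k"
      let ?Z' = "Z - {?z}"
      have k': "k < length zs" using k by (simp add: len)
      have zZ: "?z \<in> Z" using k' zs(1) by auto
      have fst_z: "fst ?z = b" using k k' by (simp add: t_def)
      have "(\<lambda>j. u l * snd (zs ! l) j) \<in> fun_space.span (snd ` {z \<in> ?Z'. fst z \<preceq> b})"
        if l: "l \<in> {..<length zs} - {k}" for l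
      proof (cases "u l = 0")
        case True
        then show ?thesis using fun_space.span_zero by (simp add: zero_fun_def)
      next
        case False
        then have "zs ! l \<in> {z \<in> ?Z'. fst z \<preceq> b}"
          using u(1) l k' zs by (auto simp: strand_def t_def nth_eq_iff_index_eq)
        then show ?thesis by (intro fun_space.span_scale fun_space.span_base imageI)
      qed
      then have rest: "(\<Sum>l\<in>{..<length zs} - {k}. (\<lambda>j. u l * snd (zs ! l) j))
          \<in> fun_space.span (snd ` {z \<in> ?Z'. fst z \<preceq> b})" 
        by (rule fun_space.span_sum)
      define r where "r = (\<Sum>l\<in>{..<length zs} - {k}. (\<lambda>j. u l * snd (zs ! l) j))"
      have sum0: "(\<lambda>j. u k * snd ?z j) + r = 0"
        using u(2) k' unfolding image r_def by (simp add: sum.remove[of _ k])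
      have "snd ?z j = - (1 / u k) * r j" for j
      proof -
        have "u k * snd ?z j + r j = 0" using fun_cong[OF sum0, of j] by simp
        then have "u k * snd ?z j = - r j" by (simp add: eq_neg_iff_add_eq_0)
        then have "(u k * snd ?z j) / u k = - r j / u k" by simp
        then show ?thesis using uk by simp
      qed
      then have "snd ?z = (\<lambda>j. - (1 / u k) * r j)" by (rule ext)
      then have z_span: "snd ?z \<in> fun_space.span (snd ` {z \<in> ?Z'. fst z \<preceq> b})"
        using fun_space.span_scale[OF rest[folded r_def], of "- (1 / u k)"] by simp
      have "K b' \<subseteq> fun_space.span (snd ` {z \<in> ?Z'. fst z \<preceq> b'})" for b'
      proof -
        have "snd z \<in> fun_space.span (snd ` {z \<in> ?Z'. fst z \<preceq> b'})" if z: "z \<in> Z" "fst z \<preceq> b'" for z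
        proof (cases "z = ?z")
          case True
          then have "snd ` {z \<in> ?Z'. fst z \<preceq> b} \<subseteq> snd ` {z \<in> ?Z'. fst z \<preceq> b'}"
            using z(2) fst_z expo_le_trans by blast
          then show ?thesis using z_span True fun_space.span_mono by blast
        next
          case False
          then show ?thesis using z by (intro fun_space.span_base) auto
        qed
        then have "snd ` {z \<in> Z. fst z \<preceq> b'} \<subseteq> fun_space.span (snd ` {z \<in> ?Z'. fst z \<preceq> b'})" by blast
        then have "fun_space.span (snd ` {z \<in> Z. fst z \<preceq> b'}) \<subseteq> fun_space.span (snd ` {z \<in> ?Z'. fst z \<preceq> b'})"
          by (rule fun_space.span_minimal) (rule fun_space.subspace_span)
        then show ?thesis using Z unfolding gen_def by blast
      qed
      then have "gen ?Z'" using Z unfolding gen_def by auto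
      moreover have "card ?Z' < card Z" using zZ Z unfolding gen_def by (intro card_Diff1_less) auto
      ultimately show False using min by fastforce
    qed
  qed
qed

section \<open>Existence of minimal multigraded resolutions\<close>

text \<open>
  The properties of the strands of a syzygy module inside the free module with basis degrees \<open>t\<close> that are
  passed on to the next syzygy module. The fourth one says that everything is generated in degrees below \<open>m\<close>, the last one
  that the module lies in the irrelevant ideal times the free module.
\<close>

definition syzygy_system ::
  "'n expo \<Rightarrow> 'n expo list \<Rightarrow> ('n expo \<Rightarrow> (nat \<Rightarrow> 'k::field) set) \<Rightarrow> bool" where
  "syzygy_system m t K \<longleftrightarrow>
     (\<forall>k < length t. t ! k \<preceq> m) \<and>
     (\<forall>b. fun_space.subspace (K b) \<and> K b \<subseteq> strand t b) \<and>
     (\<forall>a b. a \<preceq> b \<longrightarrow> K a \<subseteq> K b) \<and>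
     (\<forall>b. \<forall>u \<in> K b. \<exists>a. a \<preceq> m \<and> a \<preceq> b \<and> u \<in> K a) \<and>
     (\<forall>b. \<forall>u \<in> K b. \<forall>k < length t. t ! k = b \<longrightarrow> u k = 0)"

lemma ex_expo: "\<exists>a :: 'n::finite expo. lookup a = f"
  by (rule exI[of _ "Abs_poly_mapping f"]) (simp add: lookup_Abs_poly_mapping)

lemma ex_expo_meet:
  fixes b m :: "'n::finite expo"
  shows "\<exists>a. \<forall>d. d \<preceq> a \<longleftrightarrow> d \<preceq> b \<and> d \<preceq> m"
proof -
  obtain a :: "'n expo" where "lookup a = (\<lambda>v. min (lookup b v) (lookup m v))" using ex_expo by blast
  then show ?thesis by (intro exI[of _ a]) (auto simp: expo_le_def)
qed

text \<open>
  Minimal generators of the syzygy module \<open>K\<close> form the next free module, and their relations form the next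
  syzygy module. Its elements of degree \<open>b\<close> involve only basis elements of degree below \<open>m\<close>,
  so they come from the degree \<open>gcd(b, m)\<close>.
\<close>

lemma syzygy_system_step:
  fixes K :: "'n::finite expo \<Rightarrow> (nat \<Rightarrow> 'k::field) set"
  assumes K: "syzygy_system m t K"
  shows "\<exists>t' c. syzygy_system m t' (\<lambda>b. {u \<in> strand t' b. mat_fun (length t') c u = 0}) \<and>
    (\<forall>j k. c j k \<noteq> 0 \<longrightarrow> j < length t \<and> k < length t' \<and> t ! j \<preceq> t' ! k \<and> t ! j \<noteq> t' ! k) \<and>
    (\<forall>b. K b = mat_fun (length t') c ` strand t' b)"
proof -
  have "u j = 0" if "u \<in> K b" "j \<ge> length t" for u b j
    using K that by (fastforce simp: syzygy_system_def strand_def)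
  then have "\<exists>t' c. (\<forall>k < length t'. t' ! k \<preceq> m \<and> (\<lambda>j. c j k) \<in> K (t' ! k)) \<and>
      (\<forall>j k. k \<ge> length t' \<longrightarrow> c j k = 0) \<and>
      (\<forall>b. K b = mat_fun (length t') c ` strand t' b) \<and>
      (\<forall>b u k. u \<in> strand t' b \<longrightarrow> mat_fun (length t') c u = 0 \<longrightarrow> k < length t' \<longrightarrow> t' ! k = b \<longrightarrow> u k = 0)"
    using K by (intro minimal_graded_generators[of K "length t" m]) (auto simp: syzygy_system_def)
  then obtain t' c where t': "\<And>k. k < length t' \<Longrightarrow> t' ! k \<preceq> m \<and> (\<lambda>j. c j k) \<in> K (t' ! k)"
    "\<And>j k. k \<ge> length t' \<Longrightarrow> c j k = 0"
    "\<And>b. K b = mat_fun (length t') c ` strand t' b"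
    "\<And>b u k. u \<in> strand t' b \<Longrightarrow> mat_fun (length t') c u = 0 \<Longrightarrow> k < length t' \<Longrightarrow> t' ! k = b \<Longrightarrow> u k = 0"
    by (elim exE conjE) blast
  have support: "u j = 0 \<or> j < length t \<and> t ! j \<preceq> b" if "u \<in> K b" for u b j
  proof -
    have "K b \<subseteq> strand t b" using K by (simp add: syzygy_system_def)
    then show ?thesis using that unfolding strand_def by blast
  qed
  have minimal: "u j = 0" if "u \<in> K b" "j < length t" "t ! j = b" for u b j
    using K that by (simp add: syzygy_system_def)
  have "j < length t \<and> k < length t' \<and> t ! j \<preceq> t' ! k \<and> t ! j \<noteq> t' ! k" if nz: "c j k \<noteq> 0" for j k
  proof -
    have k: "k < length t'" using t'(2) nz by (metis not_le)
    then have col: "(\<lambda>j. c j k) \<in> K (t' ! k)" using t'(1) by blast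
    have "j < length t" "t ! j \<preceq> t' ! k" using support[OF col, of j] nz by auto
    then show ?thesis using k minimal[OF col, of j] nz by blast
  qed
  moreover have "syzygy_system m t' (\<lambda>b. {u \<in> strand t' b. mat_fun (length t') c u = 0})"
    unfolding syzygy_system_def
  proof (intro conjI allI impI ballI)
    fix b u assume u: "u \<in> {u \<in> strand t' b. mat_fun (length t') c u = 0}"
    obtain a where a: "\<And>d. d \<preceq> a \<longleftrightarrow> d \<preceq> b \<and> d \<preceq> m" using ex_expo_meet by blast
    then have "u \<in> strand t' a" using u t'(1) by (auto simp: strand_def)
    then show "\<exists>a. a \<preceq> m \<and> a \<preceq> b \<and> u \<in> {u \<in> strand t' a. mat_fun (length t') c u = 0}"
      using a[of a] u by auto
  next
    fix k assume "k < length t'" then show "t' ! k \<preceq> m" using t'(1) by blast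
  next
    fix b show "fun_space.subspace {u \<in> strand t' b. mat_fun (length t') c u = 0}"
      by (rule subspace_kernel)
    show "{u \<in> strand t' b. mat_fun (length t') c u = 0} \<subseteq> strand t' b" by blast
  next
    fix a b :: "'n expo" assume "a \<preceq> b"
    from strand_mono[OF this, of t']
    show "{u \<in> strand t' a. mat_fun (length t') c u = 0} \<subseteq> {u \<in> strand t' b. mat_fun (length t') c u = 0}"
      by blast
  next
    fix b u k assume "u \<in> {u \<in> strand t' b. mat_fun (length t') c u = 0}" "k < length t'" "t' ! k = b"
    then show "u k = 0" using t'(4) by blast
  qed
  ultimately show ?thesis using t'(3) by blast
qed

lemma ex_minimal_scalar_resolution:
  fixes A :: "'n::finite expo set"
  assumes A: "finite A"
  shows "\<exists>t (C :: nat \<Rightarrow> nat \<Rightarrow> nat \<Rightarrow> 'k::field). minimal_scalar_resolution (upset A) t C"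
proof -
  let ?U = "upset A"
  \<comment> \<open>The product of the generators, as a common multiple of them.\<close>
  define m where "m = sum (\<lambda>a. a) A"
  have m: "a \<preceq> m" if "a \<in> A" for a
    unfolding expo_le_def m_def lookup_sum using A that by (auto intro!: member_le_sum)
  define t0 :: "'n expo list" where "t0 = (if 0 \<in> ?U then [] else [0])"
  define K0 :: "'n expo \<Rightarrow> (nat \<Rightarrow> 'k) set" where "K0 b = {u \<in> strand t0 b. b \<in> ?U \<or> u = 0}" for b
  have t0: "t0 = [] \<and> 0 \<in> ?U \<or> t0 = [0] \<and> 0 \<notin> ?U" by (simp add: t0_def)
  have up: "b \<in> ?U" if "a \<in> ?U" "a \<preceq> b" for a b
    using that expo_le_trans unfolding upset_def by blast
  have zero_strand: "0 \<in> strand t0 b" for b by (simp add: strand_def)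
  have init: "syzygy_system m t0 K0"
    unfolding syzygy_system_def
  proof (intro conjI allI impI ballI)
    fix k assume "k < length t0" then show "t0 ! k \<preceq> m" using t0 by auto
  next
    fix b show "fun_space.subspace (K0 b)"
    proof (cases "b \<in> ?U")
      case True then show ?thesis using subspace_strand[of t0 b] by (simp add: K0_def)
    next
      case False
      then have "K0 b = {0}" using zero_strand by (auto simp: K0_def)
      then show ?thesis using fun_space.subspace_single_0 by simp
    qed
    show "K0 b \<subseteq> strand t0 b" by (auto simp: K0_def)
  next
    fix a b :: "'n expo" assume "a \<preceq> b"
    then show "K0 a \<subseteq> K0 b" using strand_mono[of a b t0] up unfolding K0_def by blast
  next
    fix b u assume u: "u \<in> K0 b"
    show "\<exists>a. a \<preceq> m \<and> a \<preceq> b \<and> u \<in> K0 a"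
    proof (cases "b \<in> ?U")
      case True
      then obtain a where a: "a \<in> A" "a \<preceq> b" by (auto simp: upset_def)
      have "u \<in> strand t0 a" using u t0 by (auto simp: K0_def strand_def)
      moreover have "a \<in> ?U" using a(1) expo_le_refl unfolding upset_def by blast
      ultimately show ?thesis using a m[OF a(1)] unfolding K0_def by blast
    next
      case False
      then have "u \<in> K0 0" using u zero_strand by (auto simp: K0_def)
      then show ?thesis using zero_expo_le by blast
    qed
  next
    fix b u k assume "u \<in> K0 b" "k < length t0" "t0 ! k = b"
    then show "u k = 0" using t0 by (auto simp: K0_def)
  qed
  define P where "P i x \<longleftrightarrow> syzygy_system m (fst x) (snd x) \<and> (i = 0 \<longrightarrow> x = (t0, K0))"
    for i :: nat and x
  define Q where "Q x y c \<longleftrightarrow> snd y = (\<lambda>b. {u \<in> strand (fst y) b. mat_fun (length (fst y)) c u = 0}) \<and>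
    (\<forall>j k. c j k \<noteq> 0 \<longrightarrow> j < length (fst x) \<and> k < length (fst y) \<and>
      fst x ! j \<preceq> fst y ! k \<and> fst x ! j \<noteq> fst y ! k) \<and>
    (\<forall>b. snd x b = mat_fun (length (fst y)) c ` strand (fst y) b)"
    for x y :: "'n expo list \<times> ('n expo \<Rightarrow> (nat \<Rightarrow> 'k) set)" and c
  have "\<exists>X. \<forall>i. P i (X i) \<and> (\<exists>c. Q (X i) (X (Suc i)) c)"
  proof (rule dependent_nat_choice)
    show "\<exists>x. P 0 x" using init by (intro exI[of _ "(t0, K0)"]) (simp add: P_def)
    fix x :: "'n expo list \<times> ('n expo \<Rightarrow> (nat \<Rightarrow> 'k) set)" and i :: nat
    assume "P i x"
    then have "syzygy_system m (fst x) (snd x)" by (simp add: P_def)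
    from syzygy_system_step[OF this] obtain t' c where
      step: "syzygy_system m t' (\<lambda>b. {u \<in> strand t' b. mat_fun (length t') c u = 0})"
        "\<forall>j k. c j k \<noteq> 0 \<longrightarrow> j < length (fst x) \<and> k < length t' \<and> fst x ! j \<preceq> t' ! k \<and> fst x ! j \<noteq> t' ! k"
        "\<forall>b. snd x b = mat_fun (length t') c ` strand t' b"
      by (elim exE conjE) (rule that)
    let ?y = "(t', \<lambda>b. {u \<in> strand t' b. mat_fun (length t') c u = 0})"
    have "P (Suc i) ?y" "Q x ?y c" using step by (simp_all add: P_def Q_def)
    then show "\<exists>y. P (Suc i) y \<and> (\<exists>c. Q x y c)" by blast
  qed
  then obtain X where X: "\<And>i. P i (X i)" "\<And>i. \<exists>c. Q (X i) (X (Suc i)) c" by blast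
  then obtain C where "\<And>i. Q (X i) (X (Suc i)) (C i)" by metis
  note C = this[unfolded Q_def]
  have X0: "X 0 = (t0, K0)" using X(1)[of 0] by (simp add: P_def)
  have "minimal_scalar_resolution ?U (\<lambda>i. fst (X i)) C"
    unfolding minimal_scalar_resolution_def scalar_resolution_def
  proof (intro conjI allI)
    show "fst (X 0) = [] \<and> 0 \<in> ?U \<or> fst (X 0) = [0]" using t0 X0 by auto
  next
    fix i j k :: nat
    show "C i j k \<noteq> 0 \<longrightarrow> j < length (fst (X i)) \<and> k < length (fst (X (Suc i))) \<and>
        fst (X i) ! j \<preceq> fst (X (Suc i)) ! k"
      "C i j k \<noteq> 0 \<longrightarrow> fst (X i) ! j \<noteq> fst (X (Suc i)) ! k"
      using C[of i] by blast+
  next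
    fix b
    show "{u \<in> strand (fst (X 0)) b. b \<in> ?U \<or> u = 0} =
        mat_fun (length (fst (X (Suc 0)))) (C 0) ` strand (fst (X (Suc 0))) b"
      using C[of 0] X0 by (simp add: K0_def)
  next
    fix i :: nat and b
    have "snd (X (Suc i)) b = {u \<in> strand (fst (X (Suc i))) b. mat_fun (length (fst (X (Suc i)))) (C i) u = 0}"
      using C[of i] by simp
    then show "{u \<in> strand (fst (X (Suc i))) b. mat_fun (length (fst (X (Suc i)))) (C i) u = 0} =
        mat_fun (length (fst (X (Suc (Suc i))))) (C (Suc i)) ` strand (fst (X (Suc (Suc i)))) b"
      using C[of "Suc i"] by simp
  qed
  then show ?thesis by blast
qed


section \<open>From scalar data to resolutions over the polynomial ring\<close>

text \<open>
  The component of multidegree \<open>b\<close> of an element of a free module, as an element of the strand at \<open>b\<close>.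
\<close>

definition strand_part :: "'n expo list \<Rightarrow> ('n, 'k::field) pol vec \<Rightarrow> 'n expo \<Rightarrow> nat \<Rightarrow> 'k" where
  "strand_part t v b = (\<lambda>k. if k < length t \<and> t ! k \<preceq> b then lookup (v $ k) (b - t ! k) else 0)"

definition monomial_mat ::
  "'n expo list \<Rightarrow> 'n expo list \<Rightarrow> (nat \<Rightarrow> nat \<Rightarrow> 'k::field) \<Rightarrow> ('n, 'k) pol mat" where
  "monomial_mat t t' c = mat (length t) (length t') (\<lambda>(j, k). single (t' ! k - t ! j) (c j k))"

lemma monomial_mat_carrier [simp]: "monomial_mat t t' c \<in> carrier_mat (length t) (length t')"
  by (simp add: monomial_mat_def)

lemma strand_part_in_strand: "strand_part t v b \<in> strand t b"
  by (auto simp: strand_part_def strand_def split: if_splits)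

lemma strand_part_zero [simp]: "strand_part t (0\<^sub>v (length t)) b = 0"
  by (auto simp: strand_part_def fun_eq_iff)

lemma lookup_eq_strand_part: "k < length t \<Longrightarrow> lookup (v $ k) e = strand_part t v (t ! k + e) k"
  by (simp add: strand_part_def)

lemma strand_part_eqI:
  assumes "v \<in> carrier_vec (length t)" "w \<in> carrier_vec (length t)"
    "\<And>b. strand_part t v b = strand_part t w b"
  shows "v = w"
proof (rule eq_vecI)
  fix k assume "k < dim_vec w"
  then have k: "k < length t" using assms by simp
  show "v $ k = w $ k"
    by (rule poly_mapping_eqI) (simp add: lookup_eq_strand_part[OF k] assms(3))
qed (use assms in auto)

lemma finite_strand_part: "finite {b. strand_part t v b \<noteq> 0}"
proof (rule finite_subset)
  show "{b. strand_part t v b \<noteq> 0} \<subseteq> (\<Union>k<length t. (\<lambda>e. t ! k + e) ` keys (v $ k))"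
  proof clarify
    fix b assume "strand_part t v b \<noteq> 0"
    then obtain k where "strand_part t v b k \<noteq> 0" by (auto simp: fun_eq_iff)
    then have k: "k < length t" "t ! k \<preceq> b" "lookup (v $ k) (b - t ! k) \<noteq> 0"
      by (auto simp: strand_part_def split: if_splits)
    then have "b = t ! k + (b - t ! k)" by (simp add: expo_le_add_diff)
    then show "b \<in> (\<Union>k<length t. (\<lambda>e. t ! k + e) ` keys (v $ k))"
      using k by (intro UN_I[of k] image_eqI[of _ _ "b - t ! k"]) (auto simp: in_keys_iff)
  qed
qed simp

lemma ex_strand_parts:
  fixes W :: "'n expo \<Rightarrow> nat \<Rightarrow> 'k::field"
  assumes W: "\<And>b. W b \<in> strand t b" and fin: "finite {b. W b \<noteq> 0}"
  shows "\<exists>v \<in> carrier_vec (length t). \<forall>b. strand_part t v b = W b"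
proof (intro bexI allI)
  let ?v = "vec (length t) (\<lambda>k. Abs_poly_mapping (\<lambda>e. W (t ! k + e) k))"
  show "?v \<in> carrier_vec (length t)" by simp
  have "finite {e. W (t ! k + e) k \<noteq> 0}" for k
  proof (rule finite_imageD)
    show "finite ((\<lambda>e. t ! k + e) ` {e. W (t ! k + e) k \<noteq> 0})"
      by (rule finite_subset[OF _ fin]) auto
  qed simp
  then have "lookup (?v $ k) e = W (t ! k + e) k" if "k < length t" for k e
    using that by simp
  moreover have "W b k = 0" if "\<not> (k < length t \<and> t ! k \<preceq> b)" for b k
    using W[of b] that by (auto simp: strand_def)
  ultimately show "strand_part t ?v b = W b" for b
    by (auto simp: strand_part_def expo_le_add_diff fun_eq_iff simp del: index_vec)
qed

lemma strand_part_mult: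
  assumes v: "v \<in> carrier_vec (length t')"
    and c: "\<And>j k. c j k \<noteq> 0 \<Longrightarrow> j < length t \<and> k < length t' \<and> t ! j \<preceq> t' ! k"
  shows "strand_part t (monomial_mat t t' c *\<^sub>v v) b = mat_fun (length t') c (strand_part t' v b)"
proof
  fix j
  show "strand_part t (monomial_mat t t' c *\<^sub>v v) b j = mat_fun (length t') c (strand_part t' v b) j"
  proof (cases "j < length t \<and> t ! j \<preceq> b")
    case False
    then have "c j k * strand_part t' v b k = 0" for k
      using c[of j k] expo_le_trans by (auto simp: strand_part_def)
    then have "mat_fun (length t') c (strand_part t' v b) j = 0"
      unfolding mat_fun_def by (simp only: sum.neutral_const)
    then show ?thesis using False by (auto simp: strand_part_def)
  next
    case True
    have "lookup (single (t' ! k - t ! j) (c j k) * v $ k) (b - t ! j) = c j k * strand_part t' v b k"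
      if k: "k < length t'" for k
    proof (cases "c j k = 0")
      case False
      then have le: "t ! j \<preceq> t' ! k" using c by blast
      have "t' ! k - t ! j \<preceq> b - t ! j \<longleftrightarrow> t' ! k \<preceq> b"
        using le True unfolding expo_le_def lookup_minus by (metis diff_le_mono le_diff_iff)
      moreover have "b - t ! j - (t' ! k - t ! j) = b - t' ! k"
        using le by (intro poly_mapping_eqI) (simp add: expo_le_def lookup_minus)
      ultimately show ?thesis using k by (simp add: lookup_single_mult strand_part_def)
    qed simp
    then show ?thesis
      using True v by (simp add: strand_part_def mat_fun_def monomial_mat_def scalar_prod_def lookup_sum
          atLeast0LessThan)
  qed
qed

text \<open>
  Since a matrix with entries \<open>c x^(a' - a)\<close> acts on each strand by the scalars \<open>c\<close>, its image
  can be described strand by strand. Preimages are chosen in every strand, as zero wherever that is possible, so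
  that only finitely many are nonzero and they can be assembled.
\<close>

lemma image_monomial_mat:
  assumes c: "\<And>j k. c j k \<noteq> 0 \<Longrightarrow> j < length t \<and> k < length t' \<and> t ! j \<preceq> t' ! k"
    and K: "\<And>b. K b = mat_fun (length t') c ` strand t' b"
    and v: "v \<in> carrier_vec (length t)"
  shows "(\<forall>b. strand_part t v b \<in> K b) \<longleftrightarrow>
    (\<exists>w \<in> carrier_vec (length t'). monomial_mat t t' c *\<^sub>v w = v)"
proof
  assume "\<exists>w \<in> carrier_vec (length t'). monomial_mat t t' c *\<^sub>v w = v"
  then show "\<forall>b. strand_part t v b \<in> K b"
    using strand_part_mult[OF _ c] strand_part_in_strand unfolding K by blast
next
  assume "\<forall>b. strand_part t v b \<in> K b"
  then have "\<exists>u. u \<in> strand t' b \<and> mat_fun (length t') c u = strand_part t v b \<and>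
      (strand_part t v b = 0 \<longrightarrow> u = 0)" for b
  proof (cases "strand_part t v b = 0")
    case True then show ?thesis by (intro exI[of _ 0]) (simp add: strand_def)
  next
    case False
    have "strand_part t v b \<in> mat_fun (length t') c ` strand t' b"
      using \<open>\<forall>b. strand_part t v b \<in> K b\<close> K by blast
    then show ?thesis using False by auto
  qed
  then obtain W where W: "\<And>b. W b \<in> strand t' b \<and> mat_fun (length t') c (W b) = strand_part t v b \<and>
      (strand_part t v b = 0 \<longrightarrow> W b = 0)" by metis
  have "finite {b. W b \<noteq> 0}"
    by (rule finite_subset[OF _ finite_strand_part[of t v]]) (use W in auto)
  then obtain w where w: "w \<in> carrier_vec (length t')" "\<And>b. strand_part t' w b = W b"
    using ex_strand_parts[of W t'] W by blast
  have "monomial_mat t t' c *\<^sub>v w = v"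
  proof (rule strand_part_eqI[OF _ v])
    show "monomial_mat t t' c *\<^sub>v w \<in> carrier_vec (length t)"
      using w(1) by (intro mult_mat_vec_carrier[OF monomial_mat_carrier])
    show "strand_part t (monomial_mat t t' c *\<^sub>v w) b = strand_part t v b" for b
      using W by (simp add: strand_part_mult[OF w(1) c] w(2))
  qed
  then show "\<exists>w \<in> carrier_vec (length t'). monomial_mat t t' c *\<^sub>v w = v" using w(1) by blast
qed

lemma graded_monomial_mat:
  assumes c: "\<And>j k. c j k \<noteq> 0 \<Longrightarrow> t ! j \<preceq> t' ! k"
  shows "graded_mat (map (int \<circ> total_degree) t) (map (int \<circ> total_degree) t') (monomial_mat t t' c)"
proof -
  have "homogeneous_of_degree (int (total_degree (t' ! k)) - int (total_degree (t ! j)))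
      (single (t' ! k - t ! j) (c j k))" for j k
  proof (cases "c j k = 0")
    case True then show ?thesis by (simp add: homogeneous_of_degree_def)
  next
    case False
    have "total_degree (t' ! k) = total_degree (t ! j) + total_degree (t' ! k - t ! j)"
      by (metis c[OF False] expo_le_add_diff total_degree_add)
    then show ?thesis by (simp add: homogeneous_of_degree_def)
  qed
  then show ?thesis by (simp add: graded_mat_def monomial_mat_def)
qed

lemma graded_free_resolution_of_scalar:
  fixes C :: "nat \<Rightarrow> nat \<Rightarrow> nat \<Rightarrow> 'k::field" and t :: "nat \<Rightarrow> 'n::finite expo list"
  assumes res: "scalar_resolution (upset A) t C"
  shows "graded_free_resolution (ideal_generated (monomial ` A)) (\<lambda>i. map (int \<circ> total_degree) (t i))
    (vec (length (t 0)) (\<lambda>_. 1)) (\<lambda>i. monomial_mat (t i) (t (Suc i)) (C i))"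
proof -
  let ?I = "ideal_generated (monomial ` A) :: ('n, 'k) pol set"
  let ?\<epsilon> = "vec (length (t 0)) (\<lambda>_. 1) :: ('n, 'k) pol vec"
  let ?D = "\<lambda>i. monomial_mat (t i) (t (Suc i)) (C i)"
  have t0: "t 0 = [] \<and> 0 \<in> upset A \<or> t 0 = [0]"
    and supp: "\<And>i j k. C i j k \<noteq> 0 \<Longrightarrow> j < length (t i) \<and> k < length (t (Suc i)) \<and> t i ! j \<preceq> t (Suc i) ! k"
    and ex0: "\<And>b. {u \<in> strand (t 0) b. b \<in> upset A \<or> u = 0} =
        mat_fun (length (t (Suc 0))) (C 0) ` strand (t (Suc 0)) b"
    and ex: "\<And>i b. {u \<in> strand (t (Suc i)) b. mat_fun (length (t (Suc i))) (C i) u = 0} =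
        mat_fun (length (t (Suc (Suc i)))) (C (Suc i)) ` strand (t (Suc (Suc i))) b"
    using res unfolding scalar_resolution_def by blast+
  have everything: "f \<in> ?I" if "t 0 = []" for f
  proof -
    have "0 \<in> A" using t0 that by (auto simp: upset_def)
    then show ?thesis using zero_expo_le unfolding ideal_generated_monomials upset_def by blast
  qed
  have surj: "\<exists>v \<in> carrier_vec (length (t 0)). f - ?\<epsilon> \<bullet> v \<in> ?I" for f
  proof (cases "t 0 = []")
    case True then show ?thesis using everything by (intro bexI[of _ "0\<^sub>v (length (t 0))"]) auto
  next
    case False
    then have "length (t 0) = 1" using t0 by simp
    then show ?thesis
      by (intro bexI[of _ "vec 1 (\<lambda>_. f)"]) (simp_all add: scalar_prod_def ideal_generated_monomials)
  qed
  have base: "?\<epsilon> \<bullet> v \<in> ?I \<longleftrightarrow> (\<exists>w \<in> carrier_vec (length (t (Suc 0))). ?D 0 *\<^sub>v w = v)"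
    if v: "v \<in> carrier_vec (length (t 0))" for v
  proof -
    have "?\<epsilon> \<bullet> v \<in> ?I \<longleftrightarrow> (\<forall>b. b \<in> upset A \<or> strand_part (t 0) v b = 0)"
    proof (cases "t 0 = []")
      case True
      then show ?thesis using everything by (auto simp: strand_part_def fun_eq_iff)
    next
      case False
      then have t0: "t 0 = [0]" using t0 by blast
      have "?\<epsilon> \<bullet> v = v $ 0" using v t0 by (simp add: scalar_prod_def)
      moreover have "strand_part (t 0) v b = 0 \<longleftrightarrow> lookup (v $ 0) b = 0" for b
        using t0 by (auto simp: strand_part_def fun_eq_iff)
      ultimately show ?thesis by (auto simp: ideal_generated_monomials in_keys_iff)
    qed
    also have "\<dots> \<longleftrightarrow> (\<forall>b. strand_part (t 0) v b \<in> {u \<in> strand (t 0) b. b \<in> upset A \<or> u = 0})"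
      using strand_part_in_strand by blast
    also have "\<dots> \<longleftrightarrow> (\<exists>w \<in> carrier_vec (length (t (Suc 0))). ?D 0 *\<^sub>v w = v)"
      by (rule image_monomial_mat[OF supp ex0 v])
    finally show ?thesis .
  qed
  have step: "?D i *\<^sub>v v = 0\<^sub>v (length (t i)) \<longleftrightarrow>
      (\<exists>w \<in> carrier_vec (length (t (Suc (Suc i)))). ?D (Suc i) *\<^sub>v w = v)"
    if v: "v \<in> carrier_vec (length (t (Suc i)))" for i v
  proof -
    have "?D i *\<^sub>v v = 0\<^sub>v (length (t i)) \<longleftrightarrow>
        (\<forall>b. strand_part (t i) (?D i *\<^sub>v v) b = strand_part (t i) (0\<^sub>v (length (t i))) b)"
      using strand_part_eqI[OF mult_mat_vec_carrier[OF monomial_mat_carrier v] zero_carrier_vec] by metis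
    also have "\<dots> \<longleftrightarrow> (\<forall>b. mat_fun (length (t (Suc i))) (C i) (strand_part (t (Suc i)) v b) = 0)"
      by (simp add: strand_part_mult[OF v supp])
    also have "\<dots> \<longleftrightarrow> (\<forall>b. strand_part (t (Suc i)) v b \<in>
        {u \<in> strand (t (Suc i)) b. mat_fun (length (t (Suc i))) (C i) u = 0})"
      using strand_part_in_strand by blast
    also have "\<dots> \<longleftrightarrow> (\<exists>w \<in> carrier_vec (length (t (Suc (Suc i)))). ?D (Suc i) *\<^sub>v w = v)"
      by (rule image_monomial_mat[OF supp ex v])
    finally show ?thesis .
  qed
  show ?thesis
    unfolding graded_free_resolution_def length_map
  proof (intro conjI allI impI)
    show "?\<epsilon> \<in> carrier_vec (length (t 0))" by simp
    show "homogeneous_of_degree (map (int \<circ> total_degree) (t 0) ! k) (?\<epsilon> $ k)" if "k < length (t 0)" for k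
      using that t0 by (auto simp: homogeneous_of_degree_def total_degree_def)
    show "?D i \<in> carrier_mat (length (t i)) (length (t (Suc i)))" for i by simp
    show "homogeneous_of_degree (map (int \<circ> total_degree) (t (Suc i)) ! k - map (int \<circ> total_degree) (t i) ! j)
        (?D i $$ (j, k))" if "j < length (t i)" "k < length (t (Suc i))" for i j k
      using graded_monomial_mat[of "C i" "t i" "t (Suc i)"] supp that by (simp add: graded_mat_def)
    show "\<exists>v \<in> carrier_vec (length (t 0)). f - ?\<epsilon> \<bullet> v \<in> ?I" for f by (rule surj)
    show "{v \<in> carrier_vec (length (t 0)). ?\<epsilon> \<bullet> v \<in> ?I} = (\<lambda>w. ?D 0 *\<^sub>v w) ` carrier_vec (length (t 1))"
      using base mult_mat_vec_carrier[OF monomial_mat_carrier[of "t 0" "t (Suc 0)" "C 0"]]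
      by (simp add: image_def) blast
    show "mat_kernel (?D i) = (\<lambda>w. ?D (Suc i) *\<^sub>v w) ` carrier_vec (length (t (Suc (Suc i))))" for i
      using step[of _ i] mult_mat_vec_carrier[OF monomial_mat_carrier[of "t (Suc i)" "t (Suc (Suc i))" "C (Suc i)"]]
      unfolding mat_kernel[OF monomial_mat_carrier] by (simp add: image_def) blast
  qed
qed

lemma minimal_graded_free_resolution_of_scalar:
  fixes C :: "nat \<Rightarrow> nat \<Rightarrow> nat \<Rightarrow> 'k::field" and t :: "nat \<Rightarrow> 'n::finite expo list"
  assumes res: "minimal_scalar_resolution (upset A) t C"
  shows "minimal_graded_free_resolution (ideal_generated (monomial ` A)) (\<lambda>i. map (int \<circ> total_degree) (t i))
    (vec (length (t 0)) (\<lambda>_. 1)) (\<lambda>i. monomial_mat (t i) (t (Suc i)) (C i))"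
proof -
  have le: "\<forall>i j k. C i j k \<noteq> 0 \<longrightarrow> j < length (t i) \<and> k < length (t (Suc i)) \<and> t i ! j \<preceq> t (Suc i) ! k"
    using res unfolding minimal_scalar_resolution_def scalar_resolution_def by (elim conjE)
  have neq: "\<forall>i j k. C i j k \<noteq> 0 \<longrightarrow> t i ! j \<noteq> t (Suc i) ! k"
    using res unfolding minimal_scalar_resolution_def by (elim conjE)
  have "lookup (single (t (Suc i) ! k - t i ! j) (C i j k)) 0 = 0" for i j k
  proof (cases "C i j k = 0")
    case False
    then have "t (Suc i) ! k - t i ! j \<noteq> 0"
      using le neq expo_le_add_diff by (metis add.right_neutral)
    then show ?thesis by (simp add: lookup_single)
  qed simp
  then show ?thesis
    using res graded_free_resolution_of_scalar[of A t C]
    unfolding minimal_graded_free_resolution_def minimal_scalar_resolution_def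
    by (simp add: irrelevant_ideal_iff monomial_mat_def)
qed

section \<open>Regularity under relabelling of exponents\<close>

lemma minimal_graded_imp_graded:
  "minimal_graded_free_resolution I s \<epsilon> D \<Longrightarrow> graded_free_resolution I s \<epsilon> D"
  unfolding minimal_graded_free_resolution_def by blast

text \<open>
  The graded Betti numbers are read off from an arbitrarily chosen minimal resolution. Any
  two minimal resolutions have the same degrees by comparison in both directions, so a
  multigraded one may be used.
\<close>

lemma reg_quotient_eq_Sup:
  fixes A :: "'n::finite expo set" and C :: "nat \<Rightarrow> nat \<Rightarrow> nat \<Rightarrow> 'k::field"
  assumes res: "minimal_scalar_resolution (upset A) t C"
  shows "reg_quotient (ideal_generated (monomial ` A) :: ('n, 'k) pol set) =
    Sup {ereal (real_of_int (int (total_degree a) - int i)) | i a. a \<in> set (t i)}"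
proof -
  let ?I = "ideal_generated (monomial ` A) :: ('n, 'k) pol set"
  let ?s = "SOME s. \<exists>\<epsilon> D. minimal_graded_free_resolution ?I s \<epsilon> D"
  note t = minimal_graded_free_resolution_of_scalar[OF res]
  then have "\<exists>s \<epsilon> D. minimal_graded_free_resolution ?I s \<epsilon> D" by blast
  then have "\<exists>\<epsilon> D. minimal_graded_free_resolution ?I ?s \<epsilon> D" by (rule someI_ex)
  then obtain \<epsilon> D where s: "minimal_graded_free_resolution ?I ?s \<epsilon> D" by blast
  have s': "graded_free_resolution ?I ?s \<epsilon> D" using s by (rule minimal_graded_imp_graded)
  note t' = minimal_graded_imp_graded[OF t]
  have "set (?s i) = set (map (int \<circ> total_degree) (t i))" for i
    using minimal_resolution_degrees_subset[OF refl s t'] minimal_resolution_degrees_subset[OF refl t s']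
    by (rule subset_antisym)
  then have betti: "betti ?I i j \<noteq> 0 \<longleftrightarrow> (\<exists>a \<in> set (t i). j = int (total_degree a))" for i j
    unfolding betti_def by (auto simp: count_list_0_iff)
  have "{ereal (real_of_int (j - int i)) | i j. betti ?I i j \<noteq> 0} =
      {ereal (real_of_int (int (total_degree a) - int i)) | i a. a \<in> set (t i)}" unfolding betti by blast
  then show ?thesis by (simp add: reg_quotient_def)
qed

text \<open>
  Relabelling a minimal multigraded resolution by \<open>\<Phi>\<close> gives a possibly non-minimal one for the new
  ideal. The degrees of the minimal resolution are among its degrees, and these
  exceed the old ones by at most \<open>c\<close>.
\<close>

theorem reg_quotient_relabel_le:
  fixes A :: "'n::finite expo set"
  assumes A: "finite A"
    and gal: "\<And>a b. \<Phi> a \<preceq> b \<longleftrightarrow> a \<preceq> \<Psi> b"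
    and deg: "\<And>a. total_degree (\<Phi> a) \<le> total_degree a + c"
  shows "reg_quotient (ideal_generated (monomial ` \<Phi> ` A) :: ('n, 'k::field) pol set)
    \<le> reg_quotient (ideal_generated (monomial ` A) :: ('n, 'k) pol set) + ereal (real c)"
proof -
  let ?I = "ideal_generated (monomial ` A) :: ('n, 'k) pol set"
  let ?J = "ideal_generated (monomial ` \<Phi> ` A) :: ('n, 'k) pol set"
  obtain t and C :: "nat \<Rightarrow> nat \<Rightarrow> nat \<Rightarrow> 'k" where t: "minimal_scalar_resolution (upset A) t C"
    using ex_minimal_scalar_resolution[OF A] by blast
  obtain r and B :: "nat \<Rightarrow> nat \<Rightarrow> nat \<Rightarrow> 'k" where r: "minimal_scalar_resolution (upset (\<Phi> ` A)) r B"
    using ex_minimal_scalar_resolution[OF finite_imageI[OF A]] by blast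
  have "scalar_resolution (upset (\<Phi> ` A)) (\<lambda>i. map \<Phi> (t i)) C"
    using t scalar_resolution_relabel[OF gal] unfolding minimal_scalar_resolution_def by blast
  note sub = minimal_resolution_degrees_subset[OF refl minimal_graded_free_resolution_of_scalar[OF r]
      graded_free_resolution_of_scalar[OF this]]
  have "ereal (real_of_int (int (total_degree b) - int i)) \<le> reg_quotient ?I + ereal (real c)"
    if b: "b \<in> set (r i)" for i b
  proof -
    have "int (total_degree b) \<in> set (map (int \<circ> total_degree) (map \<Phi> (t i)))"
      using sub[of i] b by auto
    then obtain a where a: "a \<in> set (t i)" "total_degree b = total_degree (\<Phi> a)" by auto
    have "ereal (real_of_int (int (total_degree b) - int i))
        \<le> ereal (real_of_int (int (total_degree a) - int i)) + ereal (real c)"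
      using deg[of a] a(2) by simp
    also have "ereal (real_of_int (int (total_degree a) - int i)) \<le> reg_quotient ?I"
      unfolding reg_quotient_eq_Sup[OF t] using a(1) by (intro Sup_upper) blast
    finally show ?thesis by (simp add: add_right_mono)
  qed
  then show ?thesis unfolding reg_quotient_eq_Sup[OF r] by (intro Sup_least) blast
qed

section \<open>Changing the exponents of one variable\<close>

definition map_exponent :: "'n \<Rightarrow> (nat \<Rightarrow> nat) \<Rightarrow> 'n expo \<Rightarrow> 'n expo" where
  "map_exponent x \<phi> a = Poly_Mapping.update x (\<phi> (lookup a x)) a"

lemma lookup_map_exponent:
  "lookup (map_exponent x \<phi> a) v = (if v = x then \<phi> (lookup a x) else lookup a v)"
  by (simp add: map_exponent_def lookup_update)

lemma map_exponent_galois: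
  assumes "\<And>s t. \<phi> s \<le> t \<longleftrightarrow> s \<le> \<psi> t"
  shows "map_exponent x \<phi> a \<preceq> b \<longleftrightarrow> a \<preceq> map_exponent x \<psi> b"
  unfolding expo_le_def lookup_map_exponent using assms by auto

lemma total_degree_map_exponent_le:
  assumes "\<And>s. \<phi> s \<le> s + c"
  shows "total_degree (map_exponent x \<phi> a) \<le> total_degree a + c"
proof -
  have "total_degree b = lookup b x + (\<Sum>v\<in>UNIV - {x}. lookup b v)" for b :: "'a expo"
    unfolding total_degree_def by (simp add: sum.remove[of _ x])
  then show ?thesis using assms[of "lookup a x"] by (simp add: lookup_map_exponent)
qed

lemma reg_quotient_map_exponent_le:
  fixes A :: "'n::finite expo set"
  assumes "finite A" "\<And>s t. \<phi> s \<le> t \<longleftrightarrow> s \<le> \<psi> t" "\<And>s. \<phi> s \<le> s + c"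
  shows "reg_quotient (ideal_generated (monomial ` map_exponent x \<phi> ` A) :: ('n, 'k::field) pol set)
    \<le> reg_quotient (ideal_generated (monomial ` A) :: ('n, 'k) pol set) + ereal (real c)"
  using assms
  by (intro reg_quotient_relabel_le[where \<Psi> = "map_exponent x \<psi>"] map_exponent_galois
      total_degree_map_exponent_le)

lemma map_exponent_map_exponent_image:
  assumes "\<And>a. a \<in> M \<Longrightarrow> \<phi>' (\<phi> (lookup a x)) = lookup a x"
  shows "map_exponent x \<phi>' ` map_exponent x \<phi> ` M = M"
proof -
  have "map_exponent x \<phi>' (map_exponent x \<phi> a) = a" if "a \<in> M" for a
    using assms[OF that] by (intro poly_mapping_eqI) (simp add: lookup_map_exponent)
  then show ?thesis by (simp add: image_image)
qed

theorem theorem3p7: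
  fixes I L L' :: "(('n::finite \<Rightarrow>\<^sub>0 nat) \<Rightarrow>\<^sub>0 'k::field) set"
    and x :: 'n
    and A B :: "('n \<Rightarrow>\<^sub>0 nat) set"
    and p q :: nat
  assumes monomial_ideal: "monomial_ideal I"
    and occurs: "\<exists>a \<in> min_gens I. Poly_Mapping.lookup a x \<ge> 1"
    and q: "q = Max {Poly_Mapping.lookup a x | a. a \<in> min_gens I}"
    and B: "B = {a \<in> min_gens I. Poly_Mapping.lookup a x = q}"
    and A: "A = min_gens I - B"
    and p: "p = (if A = {} then 0 else Max {Poly_Mapping.lookup a x | a. a \<in> A})"
    and L: "L = ideal_generated (monomial ` ({a - Poly_Mapping.single x 1 | a. a \<in> B} \<union> A))"
    and L': "L' = ideal_generated (monomial ` ({a - Poly_Mapping.single x (q - 1) | a. a \<in> B} \<union> A))"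
  shows "(p \<ge> 1 \<and> q - p \<ge> 2 \<longrightarrow>
            reg_quotient L \<le> reg_quotient I \<and> reg_quotient I \<le> reg_quotient L + 1) \<and>
         (p \<ge> 0 \<and> q - p = 1 \<longrightarrow> reg_quotient L \<le> reg_quotient I) \<and>
         (p = 0 \<and> q \<ge> 2 \<longrightarrow>
            reg_quotient L' \<le> reg_quotient I \<and>
            reg_quotient I \<le> reg_quotient L' + ereal (real (q - 1)))"
proof -
  let ?M = "min_gens I"
  note fin = min_gens_monomial_ideal(1)[OF monomial_ideal]
  note I = min_gens_monomial_ideal(2)[OF monomial_ideal]
  have le_q: "lookup a x \<le> q" if "a \<in> ?M" for a
    unfolding q using fin that by (intro Max_ge) (auto simp: Setcompr_eq_image)
  have q_pos: "q \<ge> 1" using occurs le_q by fastforce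
  have le_p: "lookup a x \<le> p" if "a \<in> A" for a
  proof -
    have "finite A" using fin A by simp
    then have "lookup a x \<le> Max {lookup a x | a. a \<in> A}"
      using that by (intro Max_ge) (auto simp: Setcompr_eq_image)
    then show ?thesis using p that by auto
  qed
  have M: "?M = B \<union> A" using A B by blast
  have top_or_A: "lookup a x = q \<or> a \<in> A" if "a \<in> ?M" for a using that A B by blast
  have lt_q: "lookup a x < q" if "a \<in> A" for a using that le_q[of a] A B by auto
  have gens: "{a - single x d | a. a \<in> B} \<union> A = map_exponent x \<phi> ` ?M"
    if top: "\<phi> q = q - d" and fixed: "\<And>a. a \<in> A \<Longrightarrow> \<phi> (lookup a x) = lookup a x" for \<phi> d
  proof -
    have "map_exponent x \<phi> a = a" if "a \<in> A" for a
      using fixed[OF that] by (intro poly_mapping_eqI) (simp add: lookup_map_exponent)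
    moreover have "map_exponent x \<phi> a = a - single x d" if "a \<in> B" for a
      using that top B
      by (intro poly_mapping_eqI) (auto simp: lookup_map_exponent lookup_minus lookup_single when_def)
    ultimately show ?thesis unfolding M image_Un Setcompr_eq_image by simp
  qed
  \<comment> \<open>The exponents \<open>q - 1\<close> and \<open>q\<close> get the same image; a relabelling may identify degrees.
    This covers the lower bounds of both (a) and (b).\<close>
  define down where "down s = (if s \<ge> q then s - 1 else s)" for s :: nat
  have L_gens: "L = ideal_generated (monomial ` map_exponent x down ` ?M)"
  proof -
    have "down (lookup a x) = lookup a x" if "a \<in> A" for a using lt_q[OF that] by (simp add: down_def)
    then show ?thesis unfolding L by (subst gens[of down 1]) (simp_all add: down_def)
  qed
  have L_le: "reg_quotient L \<le> reg_quotient I"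
  proof -
    \<comment> \<open>The upper adjoint sends \<open>t\<close> to the largest \<open>s\<close> with \<open>down s \<le> t\<close>.\<close>
    have "down s \<le> t \<longleftrightarrow> s \<le> (if t \<ge> q - 1 then t + 1 else t)" for s t
      using q_pos by (auto simp: down_def)
    moreover have "down s \<le> s + 0" for s by (simp add: down_def)
    ultimately have "reg_quotient L \<le> reg_quotient I + ereal (real 0)"
      unfolding L_gens by (subst I) (rule reg_quotient_map_exponent_le[OF fin])
    then show ?thesis by simp
  qed
  have I_le: "reg_quotient I \<le> reg_quotient L + 1" if "p \<ge> 1" "q - p \<ge> 2"
  proof -
    \<comment> \<open>Inverse to \<open>down\<close> on the values that occur: those below \<open>q\<close> are at most \<open>p < q - 1\<close>.\<close>
    define up where "up s = (if s \<ge> q - 1 then s + 1 else s)" for s :: nat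
    have "up (down (lookup a x)) = lookup a x" if "a \<in> ?M" for a
      using le_p[of a] top_or_A[OF that] \<open>q - p \<ge> 2\<close> by (auto simp: up_def down_def)
    then have inv: "map_exponent x up ` map_exponent x down ` ?M = ?M"
      by (rule map_exponent_map_exponent_image)
    have "up s \<le> t \<longleftrightarrow> s \<le> (if t \<ge> q then t - 1 else min t (q - 2))" for s t
      using \<open>q - p \<ge> 2\<close> by (auto simp: up_def)
    moreover have "up s \<le> s + 1" for s by (simp add: up_def)
    ultimately have "reg_quotient (ideal_generated (monomial ` map_exponent x up ` map_exponent x down ` ?M)
        :: ('n, 'k) pol set) \<le> reg_quotient L + ereal (real 1)"
      unfolding L_gens by (rule reg_quotient_map_exponent_le[OF finite_imageI[OF fin]])
    then show ?thesis by (simp add: inv I[symmetric] one_ereal_def)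
  qed
  have L': "reg_quotient L' \<le> reg_quotient I \<and> reg_quotient I \<le> reg_quotient L' + ereal (real (q - 1))"
    if "p = 0" "q \<ge> 2"
  proof -
    have A0: "lookup a x = 0" if "a \<in> A" for a using le_p[OF that] \<open>p = 0\<close> by simp
    \<comment> \<open>Only the values at \<open>0\<close> and \<open>q\<close> matter for the generators. The others
      are chosen to make \<open>up\<close> the upper adjoint.\<close>
    define down where "down s = (if s = 0 then 0 else max 1 (s - (q - 1)))" for s :: nat
    define up where "up s = (if s = 0 then 0 else s + (q - 1))" for s :: nat
    have L'_gens: "L' = ideal_generated (monomial ` map_exponent x down ` ?M)"
    proof -
      have "down (lookup a x) = lookup a x" if "a \<in> A" for a using A0[OF that] by (simp add: down_def)
      then show ?thesis unfolding L' using \<open>q \<ge> 2\<close> by (subst gens[of down "q - 1"]) (simp_all add: down_def)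
    qed
    have "up (down (lookup a x)) = lookup a x" if "a \<in> ?M" for a
      using A0[of a] top_or_A[OF that] \<open>q \<ge> 2\<close> by (auto simp: up_def down_def)
    then have inv: "map_exponent x up ` map_exponent x down ` ?M = ?M"
      by (rule map_exponent_map_exponent_image)
    have "down s \<le> t \<longleftrightarrow> s \<le> up t" for s t by (auto simp: up_def down_def)
    moreover have "down s \<le> s + 0" for s by (simp add: down_def)
    ultimately have "reg_quotient L' \<le> reg_quotient I + ereal (real 0)"
      unfolding L'_gens by (subst I) (rule reg_quotient_map_exponent_le[OF fin])
    moreover have "up s \<le> t \<longleftrightarrow> s \<le> t - (q - 1)" for s t by (auto simp: up_def)
    moreover have "up s \<le> s + (q - 1)" for s by (simp add: up_def)
    ultimately have "reg_quotient L' \<le> reg_quotient I" and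
      "reg_quotient (ideal_generated (monomial ` map_exponent x up ` map_exponent x down ` ?M)
        :: ('n, 'k) pol set) \<le> reg_quotient L' + ereal (real (q - 1))"
      using reg_quotient_map_exponent_le[OF finite_imageI[OF fin], of up "\<lambda>t. t - (q - 1)" "q - 1"]
      unfolding L'_gens by simp_all
    then show ?thesis by (simp add: inv I[symmetric])
  qed
  show ?thesis using L_le I_le L' by blast
qed

end
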